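(* Let $M$ be a von Neumann algebra with separable predual equipped with a faithful normal state $\varphi$, and let $P\in\mathcal{E}_\varphi$. Then the set $$\mathcal{H}_P:=\{N\in\mathcal{E}_\varphi \mid P\subseteq N \text{ and } N \text{ has the Haagerup property relative to } P\}$$ is closed in $\mathcal{E}_\varphi$.
   Context: $\mathcal{E}_\varphi$ is the set of (unital) von Neumann subalgebras $N\subseteq M$ admitting a (necessarily unique and normal) conditional expectation $\mathbb{E}_N^\varphi:M\to N$ with $\varphi\circ\mathbb{E}_N^\varphi=\varphi$, with the topology of pointwise convergence of the maps $\mathbb{E}_N^\varphi$ in $\|x\|_{2,\varphi}=\varphi(x^*x)^{1/2}$. For $P\subseteq N$ in $\mathcal{E}_\varphi$, let $e_P$ be the orthogonal projection of $\mathrm{L}^2(N,\varphi)$ onto $\mathrm{L}^2(P,\varphi)$ and $\mathcal{K}_\varphi(N,P):=\overline{\mathrm{Span}}^{\|\cdot\|}\{xe_Py: x,y\in N\}\subset\mathbf{B}(\mathrm{L}^2(N,\varphi))$. For a normal unital completely positive (ucp) map $\Phi:N\to N$ with $\varphi\circ\Phi\le\varphi$, let $\widehat\Phi$ be the bounded operator on $\mathrm{L}^2(N,\varphi)$ given by $\widehat\Phi(x\Omega_\varphi)=\Phi(x)\Omega_\varphi$, $\Omega_\varphi$ being the GNS cyclic vector. $N$ has the Haagerup property relative to $P$ if for all $\varepsilon>0$, $k\ge1$ and $x_1,\dots,x_k$ in the unit ball of $N$ there is a normal ucp $P$-$P$-bimodular map $\Phi:N\to N$ such that $\varphi\circ\Phi\le\varphi$,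 $\widehat\Phi\in\mathcal{K}_\varphi(N,P)$, and $\|\Phi(x_j)-x_j\|_{2,\varphi}<\varepsilon$ for all $j$. *)

theory Defs
  imports "HOL-Analysis.Analysis"
begin

text \<open>
  The inner product is linear in the first and conjugate-linear in the second variable.
  The real structure on the space is the one inherited from \<^class>\<open>banach\<close>.
\<close>

class complex_hilbert = banach +
  fixes scaleC :: "complex \<Rightarrow> 'a \<Rightarrow> 'a"  (infixr "*\<^sub>C" 75)
    and cinner :: "'a \<Rightarrow> 'a \<Rightarrow> complex"
  assumes scaleC_add_right: "c *\<^sub>C (x + y) = c *\<^sub>C x + c *\<^sub>C y"
    and scaleC_add_left: "(c + d) *\<^sub>C x = c *\<^sub>C x + d *\<^sub>C x"
    and scaleC_scaleC: "c *\<^sub>C (d *\<^sub>C x) = (c * d) *\<^sub>C x"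
    and scaleC_of_real: "complex_of_real r *\<^sub>C x = r *\<^sub>R x"
    and cinner_commute: "cinner x y = cnj (cinner y x)"
    and cinner_add_left: "cinner (x + y) z = cinner x z + cinner y z"
    and cinner_scaleC_left: "cinner (c *\<^sub>C x) y = c * cinner x y"
    and cinner_self: "cinner x x = complex_of_real ((norm x)\<^sup>2)"

section \<open>Bounded operators\<close>

text \<open>
  Bounded operators on a complex Hilbert space are the complex-linear elements of the
  library type of bounded real-linear maps, whose norm is the operator norm.
\<close>

type_synonym 'h op = "'h \<Rightarrow>\<^sub>L 'h"

definition bounded_ops :: "'h::complex_hilbert op set" where
  "bounded_ops = {T. \<forall>c \<xi>. blinfun_apply T (c *\<^sub>C \<xi>) = c *\<^sub>C blinfun_apply T \<xi>}"

definition op_scale :: "complex \<Rightarrow> 'h::complex_hilbert op \<Rightarrow> 'h op" where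
  "op_scale c T = Blinfun (\<lambda>\<xi>. c *\<^sub>C blinfun_apply T \<xi>)"

lemma bounded_linear_scaleC: "bounded_linear ((*\<^sub>C) c :: 'h::complex_hilbert \<Rightarrow> 'h)"
proof (rule bounded_linear_intro[where K = "cmod c"])
  fix x y :: 'h and r :: real
  show "c *\<^sub>C (x + y) = c *\<^sub>C x + c *\<^sub>C y"
    by (rule scaleC_add_right)
  show "c *\<^sub>C (r *\<^sub>R x) = r *\<^sub>R (c *\<^sub>C x)"
    by (simp add: scaleC_of_real[symmetric] scaleC_scaleC mult.commute)
  have "cinner (c *\<^sub>C x) (c *\<^sub>C x) = c * (cnj c * cinner x x)"
    by (metis cinner_commute cinner_scaleC_left complex_cnj_mult)
  also have "\<dots> = complex_of_real ((norm x * cmod c)\<^sup>2)"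
    by (simp only: cinner_self power_mult_distrib of_real_mult complex_norm_square[of c] ac_simps)
  finally have "complex_of_real ((norm (c *\<^sub>C x))\<^sup>2) = complex_of_real ((norm x * cmod c)\<^sup>2)"
    by (simp only: cinner_self)
  then have "(norm (c *\<^sub>C x))\<^sup>2 = (norm x * cmod c)\<^sup>2"
    by (simp only: of_real_eq_iff)
  then show "norm (c *\<^sub>C x) \<le> norm x * cmod c"
    by (metis mult_nonneg_nonneg norm_ge_zero order_refl power2_eq_imp_eq)
qed

lemma op_scale_apply: "blinfun_apply (op_scale c T) \<xi> = c *\<^sub>C blinfun_apply T \<xi>"
  unfolding op_scale_def
  by (simp add: bounded_linear_Blinfun_apply blinfun.bounded_linear_right
      bounded_linear_compose[OF bounded_linear_scaleC])

definition op_adj :: "'h::complex_hilbert op \<Rightarrow> 'h op" where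
  "op_adj T = (THE S. \<forall>\<xi> \<eta>. cinner (blinfun_apply T \<xi>) \<eta> = cinner \<xi> (blinfun_apply S \<eta>))"

definition op_pos :: "'h::complex_hilbert op \<Rightarrow> bool" where
  "op_pos T \<longleftrightarrow> (\<forall>\<xi>. Im (cinner (blinfun_apply T \<xi>) \<xi>) = 0 \<and> 0 \<le> Re (cinner (blinfun_apply T \<xi>) \<xi>))"

definition op_le :: "'h::complex_hilbert op \<Rightarrow> 'h op \<Rightarrow> bool" where
  "op_le S T \<longleftrightarrow> op_pos (T - S)"

definition op_cspan :: "'h::complex_hilbert op set \<Rightarrow> 'h op set" where
  "op_cspan S = {(\<Sum>i<n. op_scale (c i) (s i)) | (n::nat) c s. \<forall>i<n. s i \<in> S}"

text \<open>For a closed subspace \<open>S\<close>.\<close>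

definition ortho_proj :: "'h::complex_hilbert set \<Rightarrow> 'h op" where
  "ortho_proj S = Blinfun (\<lambda>\<xi>. THE \<eta>. \<eta> \<in> S \<and> (\<forall>\<zeta>\<in>S. cinner (\<xi> - \<eta>) \<zeta> = 0))"

section \<open>Von Neumann algebras\<close>

definition commutant :: "'h::complex_hilbert op set \<Rightarrow> 'h op set" where
  "commutant A = {T \<in> bounded_ops. \<forall>S\<in>A. S o\<^sub>L T = T o\<^sub>L S}"

definition von_neumann_algebra :: "'h::complex_hilbert op set \<Rightarrow> bool" where
  "von_neumann_algebra A \<longleftrightarrow>
     A \<subseteq> bounded_ops \<and> (\<forall>x\<in>A. op_adj x \<in> A) \<and> commutant (commutant A) = A"

text \<open>
  The predual is the space of restrictions to \<open>A\<close> of the functionals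
  \<open>x \<mapsto> \<Sum>n. \<langle>x \<xi>\<^sub>n, \<eta>\<^sub>n\<rangle>\<close> (the ultraweakly continuous functionals), with the norm of the dual
  of \<open>A\<close>.
\<close>

definition predual :: "'h::complex_hilbert op set \<Rightarrow> ('h op \<Rightarrow> complex) set" where
  "predual A = {restrict (\<lambda>x. \<Sum>n. cinner (blinfun_apply x (\<xi> n)) (\<eta> n)) A | \<xi> \<eta>.
     summable (\<lambda>n::nat. (norm (\<xi> n))\<^sup>2) \<and> summable (\<lambda>n. (norm (\<eta> n))\<^sup>2)}"

definition functional_norm :: "'h::complex_hilbert op set \<Rightarrow> ('h op \<Rightarrow> complex) \<Rightarrow> real" where
  "functional_norm A f = (SUP x\<in>{x \<in> A. norm x \<le> 1}. cmod (f x))"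

definition separable_predual :: "'h::complex_hilbert op set \<Rightarrow> bool" where
  "separable_predual A \<longleftrightarrow>
     (\<exists>D\<subseteq>predual A. countable D \<and>
        (\<forall>f\<in>predual A. \<forall>\<epsilon>>0. \<exists>g\<in>D. functional_norm A (\<lambda>x. f x - g x) < \<epsilon>))"

text \<open>
  Normality is preservation of suprema of bounded increasing nets of self-adjoint elements.
  Suprema are taken in the self-adjoint part of the algebra; an upper bound of a nonempty set of
  self-adjoint operators is automatically self-adjoint.
\<close>

definition directed_sa :: "'h::complex_hilbert op set \<Rightarrow> 'h op set \<Rightarrow> bool" where
  "directed_sa A D \<longleftrightarrow>
     D \<noteq> {} \<and> D \<subseteq> A \<and> (\<forall>d\<in>D. op_adj d = d) \<and>
     (\<forall>a\<in>D. \<forall>b\<in>D. \<exists>c\<in>D. op_le a c \<and> op_le b c)"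

definition is_lub_in :: "'h::complex_hilbert op set \<Rightarrow> 'h op set \<Rightarrow> 'h op \<Rightarrow> bool" where
  "is_lub_in A D s \<longleftrightarrow>
     s \<in> A \<and> (\<forall>d\<in>D. op_le d s) \<and> (\<forall>t\<in>A. (\<forall>d\<in>D. op_le d t) \<longrightarrow> op_le s t)"

definition normal_map ::
    "'h::complex_hilbert op set \<Rightarrow> 'h op set \<Rightarrow> ('h op \<Rightarrow> 'h op) \<Rightarrow> bool" where
  "normal_map A B \<Phi> \<longleftrightarrow>
     (\<forall>D s. directed_sa A D \<and> is_lub_in A D s \<longrightarrow> is_lub_in B (\<Phi> ` D) (\<Phi> s))"

definition normal_functional :: "'h::complex_hilbert op set \<Rightarrow> ('h op \<Rightarrow> complex) \<Rightarrow> bool" where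
  "normal_functional A \<phi> \<longleftrightarrow>
     (\<forall>D s. directed_sa A D \<and> is_lub_in A D s \<longrightarrow> Re (\<phi> s) = (SUP d\<in>D. Re (\<phi> d)))"

definition faithful_normal_state ::
    "'h::complex_hilbert op set \<Rightarrow> ('h op \<Rightarrow> complex) \<Rightarrow> bool" where
  "faithful_normal_state A \<phi> \<longleftrightarrow>
     (\<forall>x\<in>A. \<forall>y\<in>A. \<phi> (x + y) = \<phi> x + \<phi> y) \<and>
     (\<forall>c. \<forall>x\<in>A. \<phi> (op_scale c x) = c * \<phi> x) \<and>
     (\<forall>x\<in>A. op_pos x \<longrightarrow> Im (\<phi> x) = 0 \<and> 0 \<le> Re (\<phi> x)) \<and>
     \<phi> id_blinfun = 1 \<and>
     (\<forall>x\<in>A. op_pos x \<and> \<phi> x = 0 \<longrightarrow> x = 0) \<and>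
     normal_functional A \<phi>"

definition norm2 :: "('h::complex_hilbert op \<Rightarrow> complex) \<Rightarrow> 'h op \<Rightarrow> real" where
  "norm2 \<phi> x = sqrt (Re (\<phi> (op_adj x o\<^sub>L x)))"

section \<open>Unital completely positive maps and conditional expectations\<close>

text \<open>Positivity of the \<open>n \<times> n\<close> operator matrix \<open>(x i j)\<close> as an operator on the \<open>n\<close>-fold direct sum.\<close>

definition matrix_pos :: "nat \<Rightarrow> (nat \<Rightarrow> nat \<Rightarrow> 'h::complex_hilbert op) \<Rightarrow> bool" where
  "matrix_pos n x \<longleftrightarrow>
     (\<forall>\<xi>. let q = (\<Sum>i<n. \<Sum>j<n. cinner (blinfun_apply (x i j) (\<xi> j)) (\<xi> i))
          in Im q = 0 \<and> 0 \<le> Re q)"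

definition ucp_map ::
    "'h::complex_hilbert op set \<Rightarrow> 'h op set \<Rightarrow> ('h op \<Rightarrow> 'h op) \<Rightarrow> bool" where
  "ucp_map A B \<Phi> \<longleftrightarrow>
     (\<forall>x\<in>A. \<Phi> x \<in> B) \<and>
     (\<forall>x\<in>A. \<forall>y\<in>A. \<Phi> (x + y) = \<Phi> x + \<Phi> y) \<and>
     (\<forall>c. \<forall>x\<in>A. \<Phi> (op_scale c x) = op_scale c (\<Phi> x)) \<and>
     \<Phi> id_blinfun = id_blinfun \<and>
     (\<forall>n x. (\<forall>i<n. \<forall>j<n. x i j \<in> A) \<and> matrix_pos n x \<longrightarrow> matrix_pos n (\<lambda>i j. \<Phi> (x i j)))"

definition bimodular ::
    "'h::complex_hilbert op set \<Rightarrow> 'h op set \<Rightarrow> ('h op \<Rightarrow> 'h op) \<Rightarrow> bool" where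
  "bimodular P A \<Phi> \<longleftrightarrow>
     (\<forall>a\<in>P. \<forall>b\<in>P. \<forall>x\<in>A. \<Phi> (a o\<^sub>L x o\<^sub>L b) = a o\<^sub>L \<Phi> x o\<^sub>L b)"

definition conditional_expectation ::
    "'h::complex_hilbert op set \<Rightarrow> 'h op set \<Rightarrow> ('h op \<Rightarrow> 'h op) \<Rightarrow> bool" where
  "conditional_expectation M N E \<longleftrightarrow>
     ucp_map M N E \<and> (\<forall>x\<in>N. E x = x) \<and> bimodular N M E"

definition preserving_expectation ::
    "'h::complex_hilbert op set \<Rightarrow> ('h op \<Rightarrow> complex) \<Rightarrow> 'h op set \<Rightarrow> ('h op \<Rightarrow> 'h op) \<Rightarrow> bool" where
  "preserving_expectation M \<phi> N E \<longleftrightarrow>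
     conditional_expectation M N E \<and> (\<forall>x\<in>M. \<phi> (E x) = \<phi> x)"

definition expected_subalgebras ::
    "'h::complex_hilbert op set \<Rightarrow> ('h op \<Rightarrow> complex) \<Rightarrow> 'h op set set" where
  "expected_subalgebras M \<phi> =
     {N. von_neumann_algebra N \<and> N \<subseteq> M \<and> (\<exists>E. preserving_expectation M \<phi> N E)}"

text \<open>For \<open>\<phi>\<close> faithful, the values of this map on \<open>M\<close> do not depend on the choice.\<close>

definition the_expectation ::
    "'h::complex_hilbert op set \<Rightarrow> ('h op \<Rightarrow> complex) \<Rightarrow> 'h op set \<Rightarrow> 'h op \<Rightarrow> 'h op" where
  "the_expectation M \<phi> N = (SOME E. preserving_expectation M \<phi> N E)"

definition expected_topology ::
    "'h::complex_hilbert op set \<Rightarrow> ('h op \<Rightarrow> complex) \<Rightarrow> 'h op set topology" where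
  "expected_topology M \<phi> = topology_generated_by
     {{N \<in> expected_subalgebras M \<phi>.
         norm2 \<phi> (the_expectation M \<phi> N x - the_expectation M \<phi> N\<^sub>0 x) < \<epsilon>}
      | x N\<^sub>0 \<epsilon>. x \<in> M \<and> N\<^sub>0 \<in> expected_subalgebras M \<phi> \<and> 0 < \<epsilon>}"

section \<open>The GNS representation and the relative Haagerup property\<close>

definition gns_representation ::
    "'h::complex_hilbert op set \<Rightarrow> ('h op \<Rightarrow> complex) \<Rightarrow> ('h op \<Rightarrow> 'k::complex_hilbert op) \<Rightarrow> 'k \<Rightarrow> bool" where
  "gns_representation M \<phi> \<pi> \<Omega> \<longleftrightarrow>
     (\<forall>x\<in>M. \<pi> x \<in> bounded_ops) \<and>
     (\<forall>x\<in>M. \<forall>y\<in>M. \<pi> (x + y) = \<pi> x + \<pi> y) \<and>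
     (\<forall>c. \<forall>x\<in>M. \<pi> (op_scale c x) = op_scale c (\<pi> x)) \<and>
     (\<forall>x\<in>M. \<forall>y\<in>M. \<pi> (x o\<^sub>L y) = \<pi> x o\<^sub>L \<pi> y) \<and>
     (\<forall>x\<in>M. \<pi> (op_adj x) = op_adj (\<pi> x)) \<and>
     \<pi> id_blinfun = id_blinfun \<and>
     (\<forall>x\<in>M. \<phi> x = cinner (blinfun_apply (\<pi> x) \<Omega>) \<Omega>) \<and>
     closure ((\<lambda>x. blinfun_apply (\<pi> x) \<Omega>) ` M) = UNIV"

text \<open>
  In what follows \<open>(\<pi>, \<Omega>)\<close> is the GNS representation of \<open>(M, \<phi>)\<close>, on the space \<open>L\<^sup>2(M, \<phi>)\<close>.
  For a subalgebra \<open>N\<close>, the space \<open>L\<^sup>2(N, \<phi>)\<close> is the closure of \<open>\<pi>(N)\<Omega>\<close>: the restriction of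
  \<open>\<pi>\<close> to \<open>N\<close> and this invariant subspace, with the vector \<open>\<Omega>\<close>, is the GNS representation of
  \<open>(N, \<phi>)\<close>. A bounded operator on \<open>L\<^sup>2(N, \<phi>)\<close> is identified with its extension by \<open>0\<close> on the
  orthogonal complement; this preserves the operator norm.
\<close>

definition L2 :: "('h::complex_hilbert op \<Rightarrow> 'k::complex_hilbert op) \<Rightarrow> 'k \<Rightarrow> 'h op set \<Rightarrow> 'k set" where
  "L2 \<pi> \<Omega> N = closure ((\<lambda>x. blinfun_apply (\<pi> x) \<Omega>) ` N)"

definition jones_proj ::
    "('h::complex_hilbert op \<Rightarrow> 'k::complex_hilbert op) \<Rightarrow> 'k \<Rightarrow> 'h op set \<Rightarrow> 'k op" where
  "jones_proj \<pi> \<Omega> P = ortho_proj (L2 \<pi> \<Omega> P)"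

text \<open>The last factor below is the restriction of the operator to \<open>L\<^sup>2(N, \<phi>)\<close>.\<close>

definition relative_compacts ::
    "('h::complex_hilbert op \<Rightarrow> 'k::complex_hilbert op) \<Rightarrow> 'k \<Rightarrow> 'h op set \<Rightarrow> 'h op set \<Rightarrow> 'k op set" where
  "relative_compacts \<pi> \<Omega> N P = closure (op_cspan
     {\<pi> x o\<^sub>L jones_proj \<pi> \<Omega> P o\<^sub>L \<pi> y o\<^sub>L jones_proj \<pi> \<Omega> N | x y. x \<in> N \<and> y \<in> N})"

definition hat_op ::
    "('h::complex_hilbert op \<Rightarrow> 'k::complex_hilbert op) \<Rightarrow> 'k \<Rightarrow> 'h op set \<Rightarrow> ('h op \<Rightarrow> 'h op) \<Rightarrow> 'k op" where
  "hat_op \<pi> \<Omega> N \<Phi> =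
     (THE T. T o\<^sub>L jones_proj \<pi> \<Omega> N = T \<and>
        (\<forall>x\<in>N. blinfun_apply T (blinfun_apply (\<pi> x) \<Omega>) = blinfun_apply (\<pi> (\<Phi> x)) \<Omega>))"

definition relative_haagerup ::
    "('h::complex_hilbert op \<Rightarrow> complex) \<Rightarrow> ('h op \<Rightarrow> 'k::complex_hilbert op) \<Rightarrow> 'k \<Rightarrow> 'h op set \<Rightarrow> 'h op set \<Rightarrow> bool" where
  "relative_haagerup \<phi> \<pi> \<Omega> N P \<longleftrightarrow>
     (\<forall>\<epsilon>>0. \<forall>k\<ge>1. \<forall>x :: nat \<Rightarrow> 'h op. (\<forall>j\<in>{1..k}. x j \<in> N \<and> norm (x j) \<le> 1) \<longrightarrow>
        (\<exists>\<Phi>. ucp_map N N \<Phi> \<and> normal_map N N \<Phi> \<and> bimodular P N \<Phi> \<and>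
             (\<forall>y\<in>N. op_pos y \<longrightarrow> Re (\<phi> (\<Phi> y)) \<le> Re (\<phi> y)) \<and>
             hat_op \<pi> \<Omega> N \<Phi> \<in> relative_compacts \<pi> \<Omega> N P \<and>
             (\<forall>j\<in>{1..k}. norm2 \<phi> (\<Phi> (x j) - x j) < \<epsilon>)))"

end

theory Submission
  imports Defs
begin

text \<open>
  Write \<open>E\<^sub>N\<close> for the expectation onto \<open>N\<close> and \<open>e\<^sub>N\<close> for the projection onto \<open>L\<^sup>2(N)\<close>, so that
  \<open>e\<^sub>N x\<Omega> = E\<^sub>N(x)\<Omega>\<close>. Let \<open>N\<close> be a limit of algebras \<open>N'\<close> that contain \<open>P\<close> and have the Haagerup
  property relative to \<open>P\<close>. For \<open>p \<in> P\<close> all \<open>E\<^sub>N\<^sub>'(p)\<close> equal \<open>p\<close>, hence so does \<open>E\<^sub>N(p)\<close>, and \<open>P \<subseteq> N\<close>.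

  For the Haagerup property let \<open>x\<^sub>1, \<dots>, x\<^sub>k\<close> lie in the unit ball of \<open>N\<close>. Choose one \<open>N'\<close> for which
  every \<open>E\<^sub>N\<^sub>'(x\<^sub>j)\<close> is within \<open>\<epsilon>/2\<close> of \<open>E\<^sub>N(x\<^sub>j) = x\<^sub>j\<close>, and a map \<open>\<Phi>\<close> on \<open>N'\<close> that moves the
  contractions \<open>E\<^sub>N\<^sub>'(x\<^sub>j)\<close> by less than \<open>\<epsilon>/2\<close>. The map that works on \<open>N\<close> is the compression
  \<open>E\<^sub>N \<circ> \<Phi> \<circ> E\<^sub>N\<^sub>'\<close>. Complete positivity, normality, \<open>P\<close>-bimodularity, \<open>\<phi> \<circ> \<Phi> \<le> \<phi>\<close> and the estimate
  on the \<open>x\<^sub>j\<close> pass from \<open>\<Phi>\<close> to it because expectations are normal, completely positive,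
  \<open>P\<close>-bimodular, \<open>\<phi>\<close>-preserving and contractive in \<open>\<parallel>\<cdot>\<parallel>\<^sub>2\<close>.

  Only relative compactness needs a computation. The compressed map is implemented by
  \<open>e\<^sub>N T e\<^sub>N\<close>, where \<open>T\<close> implements \<open>\<Phi>\<close>, and \<open>T\<close> is a norm limit of combinations of operators
  \<open>a e\<^sub>P b\<close> with \<open>a, b \<in> N'\<close>. Since \<open>P\<close> lies in both \<open>N\<close> and \<open>N'\<close>, bimodularity of \<open>E\<^sub>N\<close> gives
  \<open>e\<^sub>N a e\<^sub>P = E\<^sub>N(a) e\<^sub>P\<close>, and the tower property \<open>E\<^sub>P E\<^sub>N = E\<^sub>P = E\<^sub>P E\<^sub>N\<^sub>'\<close> gives
  \<open>e\<^sub>P b e\<^sub>N\<^sub>' e\<^sub>N = e\<^sub>P E\<^sub>N(b) e\<^sub>N\<close>. So the compression of a generator over \<open>N'\<close> is a generator over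
  \<open>N\<close> (\<open>relative_compacts_compress\<close>).

  Two facts rest on Hilbert space theory developed from the inner product axioms. Normality of
  expectations, and the passage of suprema between the algebras \<open>N\<close>, \<open>N'\<close> and \<open>M\<close>, rest on the strong
  convergence of bounded monotone nets (\<open>exists_lub_of_bounded_directed\<close>). The operator that
  implements a map on \<open>L\<^sup>2\<close> exists by the Schwarz inequality for completely positive maps and
  extension by continuity (\<open>hat_op_ket\<close>).
\<close>

section \<open>Geometry of complex Hilbert spaces\<close>

lemma cinner_add_right: "cinner x (y + z) = cinner x y + cinner x z"
  for x :: "'h::complex_hilbert"
  by (metis cinner_add_left cinner_commute complex_cnj_add)

lemma cinner_scaleC_right: "cinner x (c *\<^sub>C y) = cnj c * cinner x y"
  for x :: "'h::complex_hilbert"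
  by (metis cinner_commute cinner_scaleC_left complex_cnj_mult)

lemma cinner_scaleR_left: "cinner (r *\<^sub>R x) y = r *\<^sub>R cinner x y"
  for x :: "'h::complex_hilbert"
  by (metis cinner_scaleC_left scaleC_of_real scaleR_conv_of_real)

lemma cinner_scaleR_right: "cinner x (r *\<^sub>R y) = r *\<^sub>R cinner x y"
  for x :: "'h::complex_hilbert"
  by (metis cinner_scaleC_right scaleC_of_real scaleR_conv_of_real complex_cnj_complex_of_real)

lemma cinner_minus_left: "cinner (- x) y = - cinner x y"
  for x :: "'h::complex_hilbert"
  using cinner_scaleR_left[of "-1" x y] by simp

lemma cinner_minus_right: "cinner x (- y) = - cinner x y"
  for x :: "'h::complex_hilbert"
  using cinner_scaleR_right[of x "-1" y] by simp

lemma cinner_diff_left: "cinner (x - y) z = cinner x z - cinner y z"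
  for x :: "'h::complex_hilbert"
  using cinner_add_left[of x "- y" z] by (simp add: cinner_minus_left)

lemma cinner_diff_right: "cinner x (y - z) = cinner x y - cinner x z"
  for x :: "'h::complex_hilbert"
  using cinner_add_right[of x y "- z"] by (simp add: cinner_minus_right)

lemma cinner_zero_left [simp]: "cinner 0 x = 0"
  for x :: "'h::complex_hilbert"
  using cinner_diff_left[of x x x] by simp

lemma cinner_zero_right [simp]: "cinner x 0 = 0"
  for x :: "'h::complex_hilbert"
  using cinner_diff_right[of x x x] by simp

lemma Re_cinner_self: "Re (cinner x x) = (norm x)\<^sup>2"
  for x :: "'h::complex_hilbert"
  by (simp add: cinner_self)

lemma scaleC_zero_right [simp]: "c *\<^sub>C (0 :: 'h::complex_hilbert) = 0"
  using scaleC_add_right[of c "0::'h" 0] by simp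

lemma scaleC_one [simp]: "1 *\<^sub>C x = x"
  for x :: "'h::complex_hilbert"
  using scaleC_of_real[of 1 x] by simp

lemma scaleC_minus_one: "(- 1) *\<^sub>C x = - x"
  for x :: "'h::complex_hilbert"
  using scaleC_of_real[of "-1" x] by simp

lemma scaleC_diff_right: "c *\<^sub>C (x - y) = c *\<^sub>C x - c *\<^sub>C y"
  for x :: "'h::complex_hilbert"
  by (metis add_diff_cancel diff_add_cancel scaleC_add_right)

lemma cinner_eqI:
  fixes x y :: "'h::complex_hilbert"
  assumes "\<And>z. cinner x z = cinner y z"
  shows "x = y"
proof -
  have "cinner (x - y) (x - y) = 0"
    using assms by (simp add: cinner_diff_left)
  then show ?thesis
    by (simp add: cinner_self)
qed

text \<open>
  Positivity of the left-hand side is the Cauchy--Schwarz inequality; its minimality at a nearest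
  point is the orthogonality statement of the projection theorem.
\<close>

lemma norm_sq_minus_component:
  fixes x \<zeta> :: "'h::complex_hilbert"
  assumes "\<zeta> \<noteq> 0"
  shows "(norm (x - (cinner x \<zeta> / (norm \<zeta>)\<^sup>2) *\<^sub>C \<zeta>))\<^sup>2 = (norm x)\<^sup>2 - (cmod (cinner x \<zeta>))\<^sup>2 / (norm \<zeta>)\<^sup>2"
proof -
  define a where "a = cinner x \<zeta>"
  define r where "r = complex_of_real ((norm \<zeta>)\<^sup>2)"
  have r: "r \<noteq> 0" "cnj r = r"
    using assms by (simp_all add: r_def)
  have inner: "cinner x \<zeta> = a" "cinner \<zeta> x = cnj a" "cinner \<zeta> \<zeta> = r"
    by (simp_all add: a_def r_def cinner_self flip: cinner_commute)
  have "complex_of_real ((norm (x - (a / r) *\<^sub>C \<zeta>))\<^sup>2) =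
      cinner (x - (a / r) *\<^sub>C \<zeta>) (x - (a / r) *\<^sub>C \<zeta>)"
    by (rule cinner_self[symmetric])
  also have "\<dots> = cinner x x - cnj (a / r) * a - (a / r) * cnj a + (a / r) * cnj (a / r) * r"
    by (simp add: cinner_diff_left cinner_diff_right cinner_scaleC_left cinner_scaleC_right inner
        algebra_simps)
  also have "\<dots> = cinner x x - (a * cnj a) / r"
    using r by simp
  also have "\<dots> = complex_of_real ((norm x)\<^sup>2 - (cmod a)\<^sup>2 / (norm \<zeta>)\<^sup>2)"
    using complex_norm_square[of a] by (simp add: r_def cinner_self)
  finally have "(norm (x - (a / r) *\<^sub>C \<zeta>))\<^sup>2 = (norm x)\<^sup>2 - (cmod a)\<^sup>2 / (norm \<zeta>)\<^sup>2"
    by (simp only: of_real_eq_iff)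
  then show ?thesis
    by (simp only: a_def r_def)
qed

lemma cinner_Cauchy_Schwarz: "cmod (cinner x y) \<le> norm x * norm y"
  for x :: "'h::complex_hilbert"
proof (cases "y = 0")
  case False
  have "0 \<le> (norm x)\<^sup>2 - (cmod (cinner x y))\<^sup>2 / (norm y)\<^sup>2"
    using norm_sq_minus_component[OF False, of x] by (metis zero_le_power2)
  then have "(cmod (cinner x y))\<^sup>2 \<le> (norm x * norm y)\<^sup>2"
    using False by (simp add: field_simps power_mult_distrib)
  then show ?thesis
    by (simp add: power2_le_iff_abs_le)
qed simp

lemma bounded_bilinear_cinner:
  "bounded_bilinear (cinner :: 'h::complex_hilbert \<Rightarrow> 'h \<Rightarrow> complex)"
  by unfold_locales
    (auto simp: cinner_add_left cinner_add_right cinner_scaleR_left cinner_scaleR_right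
      intro!: exI[of _ 1] cinner_Cauchy_Schwarz)

lemmas tendsto_cinner = bounded_bilinear.tendsto[OF bounded_bilinear_cinner]
lemmas continuous_on_cinner = bounded_bilinear.continuous_on[OF bounded_bilinear_cinner]

lemmas tendsto_scaleC = bounded_linear.tendsto[OF bounded_linear_scaleC]

lemma norm_sq_add:
  "(norm (x + y))\<^sup>2 = (norm x)\<^sup>2 + 2 * Re (cinner x y) + (norm y)\<^sup>2"
  for x :: "'h::complex_hilbert"
proof -
  have "Re (cinner y x) = Re (cinner x y)"
    by (subst cinner_commute) simp
  then show ?thesis
    by (simp add: Re_cinner_self[symmetric] cinner_add_left cinner_add_right)
qed

lemma parallelogram:
  "(norm (x - y))\<^sup>2 = 2 * (norm x)\<^sup>2 + 2 * (norm y)\<^sup>2 - (norm (x + y))\<^sup>2"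
  for x :: "'h::complex_hilbert"
  using norm_sq_add[of x y] norm_sq_add[of x "- y"] by (simp add: cinner_minus_right)

definition complex_subspace :: "'h::complex_hilbert set \<Rightarrow> bool" where
  "complex_subspace S \<longleftrightarrow> 0 \<in> S \<and> (\<forall>x\<in>S. \<forall>y\<in>S. x + y \<in> S) \<and> (\<forall>c. \<forall>x\<in>S. c *\<^sub>C x \<in> S)"

lemma complex_subspaceD:
  assumes "complex_subspace S"
  shows "0 \<in> S" "x \<in> S \<Longrightarrow> y \<in> S \<Longrightarrow> x + y \<in> S" "x \<in> S \<Longrightarrow> c *\<^sub>C x \<in> S"
    "x \<in> S \<Longrightarrow> r *\<^sub>R x \<in> S" "x \<in> S \<Longrightarrow> y \<in> S \<Longrightarrow> x - y \<in> S"
proof -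
  show *: "0 \<in> S" "x \<in> S \<Longrightarrow> y \<in> S \<Longrightarrow> x + y \<in> S" "x \<in> S \<Longrightarrow> c *\<^sub>C x \<in> S" for x y c
    using assms by (auto simp: complex_subspace_def)
  show "x \<in> S \<Longrightarrow> r *\<^sub>R x \<in> S"
    using *(3)[of x "complex_of_real r"] by (simp add: scaleC_of_real)
  show "x \<in> S \<Longrightarrow> y \<in> S \<Longrightarrow> x - y \<in> S"
    using *(2)[of x "- y"] *(3)[of y "-1"] by (simp add: scaleC_minus_one)
qed

lemma complex_subspace_closure:
  assumes S: "complex_subspace S"
  shows "complex_subspace (closure S)"
  unfolding complex_subspace_def
proof (intro conjI ballI allI)
  show "0 \<in> closure S"
    using complex_subspaceD(1)[OF S] closure_subset by blast
next
  fix x y assume "x \<in> closure S" "y \<in> closure S"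
  then obtain f g where "\<forall>n. f n \<in> S" "f \<longlonglongrightarrow> x" "\<forall>n. g n \<in> S" "g \<longlonglongrightarrow> y"
    by (meson closure_sequential)
  then show "x + y \<in> closure S"
    unfolding closure_sequential
    by (intro exI[of _ "\<lambda>n. f n + g n"]) (auto intro: tendsto_add complex_subspaceD[OF S])
next
  fix c x assume "x \<in> closure S"
  then obtain f where "\<forall>n. f n \<in> S" "f \<longlonglongrightarrow> x"
    by (meson closure_sequential)
  then show "c *\<^sub>C x \<in> closure S"
    unfolding closure_sequential
    by (intro exI[of _ "\<lambda>n. c *\<^sub>C f n"]) (auto intro: tendsto_scaleC complex_subspaceD[OF S])
qed

text \<open>
  A minimising sequence for the distance from \<open>\<xi>\<close> to \<open>S\<close> is Cauchy by the parallelogram law, since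
  midpoints stay in \<open>S\<close>. At the nearest point \<open>\<eta>\<close>, removing from \<open>\<xi> - \<eta>\<close> its component along some
  \<open>\<zeta> \<in> S\<close> would shorten it, unless that component is zero.
\<close>

lemma exists_orthogonal_projection:
  fixes S :: "'h::complex_hilbert set"
  assumes "closed S" and S: "complex_subspace S"
  shows "\<exists>\<eta>\<in>S. \<forall>\<zeta>\<in>S. cinner (\<xi> - \<eta>) \<zeta> = 0"
proof -
  note sub = complex_subspaceD[OF S]
  define \<delta> where "\<delta> = infdist \<xi> S"
  have ne: "S \<noteq> {}"
    using sub(1) by auto
  have le: "\<delta> \<le> norm (\<xi> - s)" if "s \<in> S" for s
    using infdist_le[OF that, of \<xi>] by (simp add: \<delta>_def dist_norm)
  have \<delta>0: "0 \<le> \<delta>"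
    by (simp add: \<delta>_def infdist_nonneg)
  have "\<exists>s\<in>S. norm (\<xi> - s) < \<delta> + 1 / real (Suc n)" for n
  proof -
    have "infdist \<xi> S < \<delta> + 1 / real (Suc n)"
      by (simp add: \<delta>_def)
    then show ?thesis
      using ne cINF_less_iff[of S "dist \<xi>" "\<delta> + 1 / real (Suc n)"]
      by (simp add: infdist_notempty dist_norm del: of_nat_Suc) (metis bdd_below.I2 norm_ge_zero)
  qed
  then obtain s where s: "\<And>n. s n \<in> S" "\<And>n. norm (\<xi> - s n) < \<delta> + 1 / real (Suc n)"
    by metis
  \<comment> \<open>The value of \<open>4(\<delta> + \<epsilon>)\<^sup>2 - (2\<delta>)\<^sup>2\<close> at \<open>\<epsilon> = 1/(N+1)\<close>, which bounds \<open>\<parallel>s\<^sub>m - s\<^sub>n\<parallel>\<^sup>2\<close>.\<close>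
  define b where "b N = 8 * \<delta> * (1 / real (Suc N)) + 4 * (1 / real (Suc N))\<^sup>2" for N
  have close: "(norm (s m - s n))\<^sup>2 \<le> b N" if "N \<le> m" "N \<le> n" for m n N
  proof -
    let ?e = "1 / real (Suc N)"
    have near: "(norm (\<xi> - s k))\<^sup>2 \<le> (\<delta> + ?e)\<^sup>2" if "N \<le> k" for k
    proof (rule power_mono)
      have "1 / real (Suc k) \<le> ?e"
        using that by (simp add: field_simps)
      then show "norm (\<xi> - s k) \<le> \<delta> + ?e"
        using s(2)[of k] by linarith
    qed simp
    \<comment> \<open>The midpoint of \<open>s\<^sub>m\<close> and \<open>s\<^sub>n\<close> is no nearer to \<open>\<xi>\<close> than \<open>\<delta>\<close>.\<close>
    have mid: "(1/2) *\<^sub>R (s m + s n) \<in> S"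
      by (intro sub s)
    have "(\<xi> - s n) + (\<xi> - s m) = 2 *\<^sub>R (\<xi> - (1/2) *\<^sub>R (s m + s n))"
      by (simp add: algebra_simps scaleR_2)
    then have "norm ((\<xi> - s n) + (\<xi> - s m)) = 2 * norm (\<xi> - (1/2) *\<^sub>R (s m + s n))"
      by (metis abs_numeral norm_scaleR)
    then have "2 * \<delta> \<le> norm ((\<xi> - s n) + (\<xi> - s m))"
      using le[OF mid] by linarith
    then have "(2 * \<delta>)\<^sup>2 \<le> (norm ((\<xi> - s n) + (\<xi> - s m)))\<^sup>2"
      using \<delta>0 by (intro power_mono) auto
    moreover have "(norm (s m - s n))\<^sup>2 = 2 * (norm (\<xi> - s n))\<^sup>2 + 2 * (norm (\<xi> - s m))\<^sup>2
        - (norm ((\<xi> - s n) + (\<xi> - s m)))\<^sup>2"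
      using parallelogram[of "\<xi> - s n" "\<xi> - s m"] by simp
    ultimately have "(norm (s m - s n))\<^sup>2 \<le> 4 * (\<delta> + ?e)\<^sup>2 - (2 * \<delta>)\<^sup>2"
      using near[OF that(1)] near[OF that(2)] by linarith
    also have "\<dots> = b N"
      unfolding b_def by (simp add: power2_sum power_mult_distrib algebra_simps)
    finally show ?thesis .
  qed
  have lim0: "(\<lambda>n. 1 / real (Suc n)) \<longlonglongrightarrow> 0"
    using LIMSEQ_inverse_real_of_nat by (simp add: inverse_eq_divide)
  have "b \<longlonglongrightarrow> 8 * \<delta> * 0 + 4 * 0\<^sup>2"
    unfolding b_def by (intro tendsto_add tendsto_mult tendsto_power tendsto_const lim0)
  then have b0: "b \<longlonglongrightarrow> 0"
    by simp
  have "Cauchy s"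
  proof (rule metric_CauchyI)
    fix e :: real assume "0 < e"
    then obtain N where N: "b N < e\<^sup>2"
      using order_tendstoD(2)[OF b0, of "e\<^sup>2"] by (auto simp: eventually_sequentially)
    have "dist (s m) (s n) < e" if "N \<le> m" "N \<le> n" for m n
      using close[OF that] N \<open>0 < e\<close>
      by (metis dist_norm less_eq_real_def order.strict_trans1 power_less_imp_less_base)
    then show "\<exists>N. \<forall>m\<ge>N. \<forall>n\<ge>N. dist (s m) (s n) < e"
      by blast
  qed
  then obtain \<eta> where lim: "s \<longlonglongrightarrow> \<eta>"
    by (meson Cauchy_convergent convergent_def)
  have \<eta>: "\<eta> \<in> S"
    using \<open>closed S\<close> s(1) lim closed_sequentially by blast
  have "norm (\<xi> - \<eta>) \<le> \<delta> + 0"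
  proof (rule LIMSEQ_le)
    show "(\<lambda>n. norm (\<xi> - s n)) \<longlonglongrightarrow> norm (\<xi> - \<eta>)"
      by (intro tendsto_intros lim)
    show "(\<lambda>n. \<delta> + 1 / real (Suc n)) \<longlonglongrightarrow> \<delta> + 0"
      by (intro tendsto_intros lim0)
    show "\<exists>N. \<forall>n\<ge>N. norm (\<xi> - s n) \<le> \<delta> + 1 / real (Suc n)"
      using s(2) less_imp_le by blast
  qed
  then have \<eta>\<delta>: "norm (\<xi> - \<eta>) \<le> \<delta>"
    by simp
  have "cinner (\<xi> - \<eta>) \<zeta> = 0" if "\<zeta> \<in> S" for \<zeta>
  proof (cases "\<zeta> = 0")
    case False
    let ?c = "cinner (\<xi> - \<eta>) \<zeta>"
    have "\<eta> + (?c / (norm \<zeta>)\<^sup>2) *\<^sub>C \<zeta> \<in> S"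
      by (intro sub that \<eta>)
    then have "\<delta> \<le> norm (\<xi> - \<eta> - (?c / (norm \<zeta>)\<^sup>2) *\<^sub>C \<zeta>)"
      using le by (metis diff_diff_eq)
    then have "(norm (\<xi> - \<eta>))\<^sup>2 \<le> (norm (\<xi> - \<eta> - (?c / (norm \<zeta>)\<^sup>2) *\<^sub>C \<zeta>))\<^sup>2"
      using \<eta>\<delta> by (intro power_mono) auto
    also have "\<dots> = (norm (\<xi> - \<eta>))\<^sup>2 - (cmod ?c)\<^sup>2 / (norm \<zeta>)\<^sup>2"
      by (rule norm_sq_minus_component[OF False])
    finally show ?thesis
      using False by (simp add: divide_le_0_iff)
  qed simp
  with \<eta> show ?thesis
    by blast
qed

section \<open>Bounded operators and adjoints\<close>

lemma bounded_opsI: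
  "(\<And>c \<xi>. blinfun_apply T (c *\<^sub>C \<xi>) = c *\<^sub>C blinfun_apply T \<xi>) \<Longrightarrow> T \<in> bounded_ops"
  by (simp add: bounded_ops_def)

lemma bounded_ops_scaleC:
  "T \<in> bounded_ops \<Longrightarrow> blinfun_apply T (c *\<^sub>C \<xi>) = c *\<^sub>C blinfun_apply T \<xi>"
  by (simp add: bounded_ops_def)

lemma bounded_ops_add: "S \<in> bounded_ops \<Longrightarrow> T \<in> bounded_ops \<Longrightarrow> S + T \<in> bounded_ops"
  by (simp add: bounded_ops_def blinfun.add_left scaleC_add_right)

lemma bounded_ops_diff: "S \<in> bounded_ops \<Longrightarrow> T \<in> bounded_ops \<Longrightarrow> S - T \<in> bounded_ops"
  by (simp add: bounded_ops_def blinfun.diff_left scaleC_diff_right)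

lemma bounded_ops_scale: "T \<in> bounded_ops \<Longrightarrow> op_scale c T \<in> bounded_ops"
  by (simp add: bounded_ops_def op_scale_apply scaleC_scaleC mult.commute)

lemma bounded_ops_compose: "S \<in> bounded_ops \<Longrightarrow> T \<in> bounded_ops \<Longrightarrow> S o\<^sub>L T \<in> bounded_ops"
  by (simp add: bounded_ops_def)

lemma bounded_ops_id: "id_blinfun \<in> bounded_ops"
  by (simp add: bounded_ops_def)

lemma op_scale_of_real: "op_scale (complex_of_real r) T = r *\<^sub>R T"
  by (rule blinfun_eqI) (simp add: op_scale_apply scaleC_of_real blinfun.scaleR_left)

lemma ortho_proj_unique:
  fixes S :: "'h::complex_hilbert set"
  assumes S: "complex_subspace S"
    and "\<eta> \<in> S" "\<forall>\<zeta>\<in>S. cinner (\<xi> - \<eta>) \<zeta> = 0" "\<eta>' \<in> S" "\<forall>\<zeta>\<in>S. cinner (\<xi> - \<eta>') \<zeta> = 0"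
  shows "\<eta> = \<eta>'"
proof -
  have "\<eta> - \<eta>' \<in> S"
    using assms complex_subspaceD(5)[OF S] by blast
  then have "cinner (\<xi> - \<eta>') (\<eta> - \<eta>') - cinner (\<xi> - \<eta>) (\<eta> - \<eta>') = 0"
    using assms by simp
  then have "cinner (\<eta> - \<eta>') (\<eta> - \<eta>') = 0"
    by (simp add: cinner_diff_left)
  then show ?thesis
    by (simp add: cinner_self)
qed

text \<open>
  Linearity follows from uniqueness of the orthogonal decomposition, boundedness from Pythagoras.
\<close>

lemma ortho_proj_characterization:
  fixes S :: "'h::complex_hilbert set"
  assumes cl: "closed S" and S: "complex_subspace S"
  shows "ortho_proj S \<in> bounded_ops"
    and "blinfun_apply (ortho_proj S) \<xi> \<in> S"
    and "\<forall>\<zeta>\<in>S. cinner (\<xi> - blinfun_apply (ortho_proj S) \<xi>) \<zeta> = 0"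
proof -
  note sub = complex_subspaceD[OF S]
  define p where "p \<xi> = (THE \<eta>. \<eta> \<in> S \<and> (\<forall>\<zeta>\<in>S. cinner (\<xi> - \<eta>) \<zeta> = 0))" for \<xi>
  have "\<exists>!\<eta>. \<eta> \<in> S \<and> (\<forall>\<zeta>\<in>S. cinner (\<xi> - \<eta>) \<zeta> = 0)" for \<xi>
    using exists_orthogonal_projection[OF cl S, of \<xi>] ortho_proj_unique[OF S] by blast
  from theI'[OF this] have p: "p \<xi> \<in> S" "\<forall>\<zeta>\<in>S. cinner (\<xi> - p \<xi>) \<zeta> = 0" for \<xi>
    unfolding p_def by blast+
  have add: "p (x + y) = p x + p y" for x y
  proof (rule ortho_proj_unique[OF S p(1) p(2)])
    show "p x + p y \<in> S"
      by (intro sub p)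
    show "\<forall>\<zeta>\<in>S. cinner (x + y - (p x + p y)) \<zeta> = 0"
      using p(2)[of x] p(2)[of y] by (simp add: cinner_add_left cinner_diff_left)
  qed
  have scale: "p (c *\<^sub>C x) = c *\<^sub>C p x" for c x
  proof (rule ortho_proj_unique[OF S p(1) p(2)])
    show "c *\<^sub>C p x \<in> S"
      by (intro sub p)
    show "\<forall>\<zeta>\<in>S. cinner (c *\<^sub>C x - c *\<^sub>C p x) \<zeta> = 0"
      using p(2)[of x] by (simp flip: scaleC_diff_right add: cinner_scaleC_left)
  qed
  have bound: "norm (p x) \<le> norm x * 1" for x
  proof -
    have "cinner (x - p x) (p x) = 0"
      using p by blast
    then have "(norm x)\<^sup>2 = (norm (x - p x))\<^sup>2 + (norm (p x))\<^sup>2"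
      using norm_sq_add[of "x - p x" "p x"] by simp
    then have "(norm (p x))\<^sup>2 \<le> (norm x)\<^sup>2"
      by simp
    then show ?thesis
      by simp
  qed
  have "bounded_linear p"
    using add scale[of "complex_of_real _"] bound
    by (intro bounded_linear_intro[where K = 1]) (simp_all add: scaleC_of_real)
  then have apply_eq: "blinfun_apply (ortho_proj S) = p"
    unfolding ortho_proj_def p_def[symmetric] by (rule bounded_linear_Blinfun_apply)
  show "ortho_proj S \<in> bounded_ops"
    by (rule bounded_opsI) (simp add: apply_eq scale)
  show "blinfun_apply (ortho_proj S) \<xi> \<in> S" "\<forall>\<zeta>\<in>S. cinner (\<xi> - blinfun_apply (ortho_proj S) \<xi>) \<zeta> = 0"
    using p by (simp_all add: apply_eq)
qed

lemma ortho_proj_eqI: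
  fixes S :: "'h::complex_hilbert set"
  assumes "closed S" "complex_subspace S" "\<eta> \<in> S" "\<And>\<zeta>. \<zeta> \<in> S \<Longrightarrow> cinner (\<xi> - \<eta>) \<zeta> = 0"
  shows "blinfun_apply (ortho_proj S) \<xi> = \<eta>"
  using ortho_proj_unique[OF assms(2)] ortho_proj_characterization[OF assms(1,2)] assms(3,4) by blast

text \<open>
  If \<open>f \<noteq> 0\<close>, its kernel has a nonzero orthogonal vector \<open>w\<close>; modulo the kernel every \<open>x\<close> is a
  multiple of \<open>w\<close>, so a multiple of \<open>w\<close> represents \<open>f\<close>.
\<close>

lemma Riesz_representation:
  fixes f :: "'h::complex_hilbert \<Rightarrow> complex"
  assumes f: "bounded_linear f" and scale: "\<And>c x. f (c *\<^sub>C x) = c * f x"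
  shows "\<exists>y. \<forall>x. f x = cinner x y"
proof (cases "\<forall>x. f x = 0")
  case True
  then show ?thesis
    by (intro exI[of _ 0]) simp
next
  case False
  then obtain z where z: "f z \<noteq> 0"
    by blast
  interpret f: bounded_linear f
    by (rule f)
  let ?S = "{x. f x = 0}"
  have sub: "complex_subspace ?S"
    unfolding complex_subspace_def by (simp add: f.add f.zero scale)
  have cl: "closed ?S"
    by (intro closed_Collect_eq continuous_intros linear_continuous_on f)
  define w where "w = z - blinfun_apply (ortho_proj ?S) z"
  have fw: "f w = f z"
    using ortho_proj_characterization(2)[OF cl sub, of z] by (simp add: w_def f.diff)
  have orth: "cinner w x = 0" if "f x = 0" for x
    using ortho_proj_characterization(3)[OF cl sub, of z] that by (simp add: w_def)
  have w0: "w \<noteq> 0"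
    using fw z f.zero by auto
  have "f x = cinner x ((cnj (f w) / (norm w)\<^sup>2) *\<^sub>C w)" for x
  proof -
    have "f (x - (f x / f w) *\<^sub>C w) = 0"
      using fw z by (simp add: f.diff scale)
    then have "cinner (x - (f x / f w) *\<^sub>C w) w = 0"
      using orth[of "x - (f x / f w) *\<^sub>C w"] cinner_commute[of w "x - (f x / f w) *\<^sub>C w"] by simp
    then have "cinner x w = (f x / f w) * (norm w)\<^sup>2"
      by (simp add: cinner_diff_left cinner_scaleC_left cinner_self)
    then show ?thesis
      using w0 fw z by (simp add: cinner_scaleC_right)
  qed
  then show ?thesis
    by blast
qed

lemma exists_adjoint:
  fixes T :: "'h::complex_hilbert op"
  assumes T: "T \<in> bounded_ops"
  shows "\<exists>S\<in>bounded_ops. \<forall>\<xi> \<eta>. cinner (blinfun_apply T \<xi>) \<eta> = cinner \<xi> (blinfun_apply S \<eta>)"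
proof -
  have "\<exists>y. \<forall>\<xi>. cinner (blinfun_apply T \<xi>) \<eta> = cinner \<xi> y" for \<eta>
  proof (rule Riesz_representation)
    show "bounded_linear (\<lambda>\<xi>. cinner (blinfun_apply T \<xi>) \<eta>)"
      by (intro bounded_linear_compose[OF bounded_bilinear.bounded_linear_left[OF bounded_bilinear_cinner]]
          blinfun.bounded_linear_right)
    show "cinner (blinfun_apply T (c *\<^sub>C \<xi>)) \<eta> = c * cinner (blinfun_apply T \<xi>) \<eta>" for c \<xi>
      by (simp add: bounded_ops_scaleC[OF T] cinner_scaleC_left)
  qed
  then obtain s where s: "\<And>\<xi> \<eta>. cinner (blinfun_apply T \<xi>) \<eta> = cinner \<xi> (s \<eta>)"
    by metis
  have ext: "x = y" if "\<And>\<xi>. cinner \<xi> x = cinner \<xi> y" for x y :: 'h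
    by (rule cinner_eqI) (simp add: cinner_commute[of x] cinner_commute[of y] that)
  have add: "s (x + y) = s x + s y" for x y
    by (rule ext) (simp flip: s add: cinner_add_right)
  have scale: "s (c *\<^sub>C x) = c *\<^sub>C s x" for c x
    by (rule ext) (simp flip: s add: cinner_scaleC_right)
  have bound: "norm (s \<eta>) \<le> norm \<eta> * norm T" for \<eta>
  proof (cases "s \<eta> = 0")
    case False
    have "(norm (s \<eta>))\<^sup>2 = cmod (cinner (blinfun_apply T (s \<eta>)) \<eta>)"
      by (simp add: s cinner_self norm_power)
    also have "\<dots> \<le> norm (blinfun_apply T (s \<eta>)) * norm \<eta>"
      by (rule cinner_Cauchy_Schwarz)
    also have "\<dots> \<le> norm T * norm (s \<eta>) * norm \<eta>"
      by (intro mult_right_mono norm_blinfun) simp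
    finally show ?thesis
      using False by (simp add: power2_eq_square mult_ac)
  qed simp
  have "bounded_linear s"
    using add scale[of "complex_of_real _"] bound
    by (intro bounded_linear_intro[where K = "norm T"]) (simp_all add: scaleC_of_real)
  then have apply_eq: "blinfun_apply (Blinfun s) = s"
    by (rule bounded_linear_Blinfun_apply)
  show ?thesis
    by (rule bexI[of _ "Blinfun s"]) (auto simp: apply_eq s scale intro: bounded_opsI)
qed

lemma op_adj_eqI:
  fixes T S :: "'h::complex_hilbert op"
  assumes "\<And>\<xi> \<eta>. cinner (blinfun_apply T \<xi>) \<eta> = cinner \<xi> (blinfun_apply S \<eta>)"
  shows "op_adj T = S"
  unfolding op_adj_def
proof (rule the_equality)
  fix R :: "'h op"
  assume "\<forall>\<xi> \<eta>. cinner (blinfun_apply T \<xi>) \<eta> = cinner \<xi> (blinfun_apply R \<eta>)"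
  then have "cinner (blinfun_apply R \<eta>) \<xi> = cinner (blinfun_apply S \<eta>) \<xi>" for \<xi> \<eta>
    using assms[of \<xi> \<eta>] cinner_commute[of "blinfun_apply R \<eta>" \<xi>] cinner_commute[of "blinfun_apply S \<eta>" \<xi>]
    by simp
  then show "R = S"
    by (intro blinfun_eqI cinner_eqI)
qed (use assms in blast)

lemma cinner_op_adj:
  assumes "T \<in> bounded_ops"
  shows "cinner (blinfun_apply T \<xi>) \<eta> = cinner \<xi> (blinfun_apply (op_adj T) \<eta>)"
    and "cinner (blinfun_apply (op_adj T) \<xi>) \<eta> = cinner \<xi> (blinfun_apply T \<eta>)"
    and "op_adj T \<in> bounded_ops"
proof -
  obtain S where S: "S \<in> bounded_ops"
    "\<And>\<xi> \<eta>. cinner (blinfun_apply T \<xi>) \<eta> = cinner \<xi> (blinfun_apply S \<eta>)"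
    using exists_adjoint[OF assms] by blast
  have eq: "op_adj T = S"
    by (rule op_adj_eqI) (rule S)
  show *: "cinner (blinfun_apply T \<xi>) \<eta> = cinner \<xi> (blinfun_apply (op_adj T) \<eta>)" for \<xi> \<eta>
    using S eq by simp
  show "cinner (blinfun_apply (op_adj T) \<xi>) \<eta> = cinner \<xi> (blinfun_apply T \<eta>)"
    using *[of \<eta> \<xi>] cinner_commute[of "blinfun_apply (op_adj T) \<xi>" \<eta>] cinner_commute[of "blinfun_apply T \<eta>" \<xi>]
    by (metis complex_cnj_cnj)
  show "op_adj T \<in> bounded_ops"
    using S eq by simp
qed

text \<open>
  The diagonal of a complex sesquilinear form determines the form: test on \<open>\<xi> + \<eta>\<close> and on
  \<open>\<i> \<xi> + \<eta>\<close>.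
\<close>

lemma quadratic_form_eq_0:
  fixes T :: "'h::complex_hilbert op"
  assumes T: "T \<in> bounded_ops" and diag: "\<And>\<xi>. cinner (blinfun_apply T \<xi>) \<xi> = 0"
  shows "T = 0"
proof (rule blinfun_eqI, rule cinner_eqI)
  fix \<xi> \<eta>
  have sum: "cinner (blinfun_apply T a) \<eta> + cinner (blinfun_apply T \<eta>) a = 0" for a
    using diag[of "a + \<eta>"] diag[of a] diag[of \<eta>]
    by (simp add: blinfun.add_right cinner_add_left cinner_add_right add.commute)
  have "\<i> * cinner (blinfun_apply T \<xi>) \<eta> - \<i> * cinner (blinfun_apply T \<eta>) \<xi> = 0"
    using sum[of "\<i> *\<^sub>C \<xi>"] by (simp add: bounded_ops_scaleC[OF T] cinner_scaleC_left cinner_scaleC_right)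
  then have "cinner (blinfun_apply T \<xi>) \<eta> = cinner (blinfun_apply T \<eta>) \<xi>"
    by simp
  with sum[of \<xi>] show "cinner (blinfun_apply T \<xi>) \<eta> = cinner (blinfun_apply 0 \<xi>) \<eta>"
    by simp
qed

lemma op_adj_eq_self_iff:
  assumes T: "T \<in> bounded_ops"
  shows "op_adj T = T \<longleftrightarrow> (\<forall>\<xi>. Im (cinner (blinfun_apply T \<xi>) \<xi>) = 0)"
proof
  assume "op_adj T = T"
  then have "cinner (blinfun_apply T \<xi>) \<xi> = cnj (cinner (blinfun_apply T \<xi>) \<xi>)" for \<xi>
    using cinner_op_adj(1)[OF T, of \<xi> \<xi>] cinner_commute[of \<xi>] by simp
  then show "\<forall>\<xi>. Im (cinner (blinfun_apply T \<xi>) \<xi>) = 0"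
    by (metis Reals_cnj_iff complex_is_Real_iff)
next
  assume im: "\<forall>\<xi>. Im (cinner (blinfun_apply T \<xi>) \<xi>) = 0"
  have "op_adj T - T = 0"
  proof (rule quadratic_form_eq_0)
    show "op_adj T - T \<in> bounded_ops"
      by (intro bounded_ops_diff cinner_op_adj T)
    fix \<xi>
    have "cinner \<xi> (blinfun_apply T \<xi>) = cinner (blinfun_apply T \<xi>) \<xi>"
      using im cinner_commute[of \<xi> "blinfun_apply T \<xi>"] by (simp add: complex_eq_iff)
    then show "cinner (blinfun_apply (op_adj T - T) \<xi>) \<xi> = 0"
      by (simp add: blinfun.diff_left cinner_diff_left cinner_op_adj(2)[OF T])
  qed
  then show "op_adj T = T"
    by simp
qed

section \<open>The operator order and bounded monotone nets\<close>

lemma op_pos_Re: "op_pos T \<Longrightarrow> 0 \<le> Re (cinner (blinfun_apply T \<xi>) \<xi>)"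
  and op_pos_Im: "op_pos T \<Longrightarrow> Im (cinner (blinfun_apply T \<xi>) \<xi>) = 0"
  by (simp_all add: op_pos_def)

lemma op_pos_add: "op_pos S \<Longrightarrow> op_pos T \<Longrightarrow> op_pos (S + T)"
  by (simp add: op_pos_def blinfun.add_left cinner_add_left)

lemma op_le_refl: "op_le T T"
  by (simp add: op_le_def op_pos_def)

lemma op_le_trans: "op_le R S \<Longrightarrow> op_le S T \<Longrightarrow> op_le R T"
  unfolding op_le_def using op_pos_add[of "S - R" "T - S"] by simp

lemma op_le_Re:
  "op_le S T \<Longrightarrow> Re (cinner (blinfun_apply S \<xi>) \<xi>) \<le> Re (cinner (blinfun_apply T \<xi>) \<xi>)"
  using op_pos_Re[of "T - S" \<xi>] by (simp add: op_le_def blinfun.diff_left cinner_diff_left)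

lemma op_le_antisym:
  assumes "op_le S T" "op_le T S" "S \<in> bounded_ops" "T \<in> bounded_ops"
  shows "S = T"
proof -
  have "S - T = 0"
  proof (rule quadratic_form_eq_0)
    fix \<xi>
    show "cinner (blinfun_apply (S - T) \<xi>) \<xi> = 0"
      using op_pos_Im[of "S - T" \<xi>] op_le_Re[OF assms(1), of \<xi>] op_le_Re[OF assms(2), of \<xi>] assms(2)
      by (simp add: op_le_def complex_eq_iff blinfun.diff_left cinner_diff_left)
  qed (use assms bounded_ops_diff in blast)
  then show ?thesis
    by simp
qed

lemma op_pos_adj_compose: "T \<in> bounded_ops \<Longrightarrow> op_pos (op_adj T o\<^sub>L T)"
  by (simp add: op_pos_def cinner_op_adj(2) cinner_self)

lemma op_pos_self_adjoint: "T \<in> bounded_ops \<Longrightarrow> op_pos T \<Longrightarrow> op_adj T = T"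
  by (simp add: op_adj_eq_self_iff op_pos_Im)

text \<open>
  Minimising \<open>t \<mapsto> \<langle>S(\<xi> - tS\<xi>), \<xi> - tS\<xi>\<rangle> \<ge> 0\<close>; the quadratic coefficient is at most
  \<open>\<parallel>T\<parallel> \<parallel>S\<xi>\<parallel>\<^sup>2\<close>. Bounding by \<open>T\<close> instead of \<open>S\<close> gives one constant for all differences \<open>S\<close> of a
  bounded increasing net.
\<close>

lemma norm_sq_positive_le:
  fixes S T :: "'h::complex_hilbert op"
  assumes S: "S \<in> bounded_ops" and pos: "op_pos S" and le: "op_le S T"
  shows "(norm (blinfun_apply S \<xi>))\<^sup>2 \<le> norm T * Re (cinner (blinfun_apply S \<xi>) \<xi>)"
proof -
  define v where "v = blinfun_apply S \<xi>"
  define a where "a = Re (cinner v \<xi>)"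
  have bound: "Re (cinner (blinfun_apply S x) x) \<le> norm T * (norm x)\<^sup>2" for x
  proof -
    have "Re (cinner (blinfun_apply S x) x) \<le> cmod (cinner (blinfun_apply T x) x)"
      using op_le_Re[OF le, of x] complex_Re_le_cmod order_trans by blast
    also have "\<dots> \<le> norm (blinfun_apply T x) * norm x"
      by (rule cinner_Cauchy_Schwarz)
    also have "\<dots> \<le> norm T * norm x * norm x"
      by (intro mult_right_mono norm_blinfun) simp
    finally show ?thesis
      by (simp add: power2_eq_square mult.assoc)
  qed
  have Sv: "cinner (blinfun_apply S v) \<xi> = cinner v v"
    using cinner_op_adj(1)[OF S, of v \<xi>] op_pos_self_adjoint[OF S pos] by (simp add: v_def)
  have quad: "0 \<le> a - 2 * t * (norm v)\<^sup>2 + t\<^sup>2 * (norm T * (norm v)\<^sup>2)" for t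
  proof -
    have "0 \<le> Re (cinner (blinfun_apply S (\<xi> - t *\<^sub>R v)) (\<xi> - t *\<^sub>R v))"
      by (rule op_pos_Re[OF pos])
    also have "\<dots> = a - 2 * t * (norm v)\<^sup>2 + t\<^sup>2 * Re (cinner (blinfun_apply S v) v)"
      by (simp add: blinfun.diff_right blinfun.scaleR_right cinner_diff_left cinner_diff_right
          cinner_scaleR_left cinner_scaleR_right Sv Re_cinner_self a_def flip: v_def)
        (simp add: power2_eq_square algebra_simps)
    also have "\<dots> \<le> a - 2 * t * (norm v)\<^sup>2 + t\<^sup>2 * (norm T * (norm v)\<^sup>2)"
      by (intro add_left_mono mult_left_mono bound) simp
    finally show ?thesis .
  qed
  show ?thesis
  proof (cases "norm T = 0")
    case True
    have "a \<le> 0"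
      using bound[of \<xi>] True by (simp add: a_def v_def)
    moreover have "2 * (norm v)\<^sup>2 \<le> a"
      using quad[of 1] True by simp
    ultimately have "(norm v)\<^sup>2 \<le> 0"
      using zero_le_power2[of "norm v"] by linarith
    then show ?thesis
      using True by (simp flip: v_def)
  next
    case False
    then have T: "norm T > 0"
      by simp
    have "0 \<le> a - (norm v)\<^sup>2 / norm T"
      using quad[of "1 / norm T"] T by (simp add: field_simps power2_eq_square)
    then show ?thesis
      using T by (simp add: field_simps flip: v_def a_def)
  qed
qed

lemma norm_positive_le:
  assumes "S \<in> bounded_ops" "op_pos S" "op_le S T"
  shows "norm (blinfun_apply S \<xi>) \<le> norm T * norm \<xi>"
proof (cases "blinfun_apply S \<xi> = 0")
  case False
  have "(norm (blinfun_apply S \<xi>))\<^sup>2 \<le> norm T * Re (cinner (blinfun_apply S \<xi>) \<xi>)"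
    by (rule norm_sq_positive_le[OF assms])
  also have "\<dots> \<le> norm T * (norm (blinfun_apply S \<xi>) * norm \<xi>)"
    by (intro mult_left_mono order_trans[OF complex_Re_le_cmod] cinner_Cauchy_Schwarz) simp
  finally show ?thesis
    using False by (simp add: power2_eq_square mult_ac)
qed simp

lemma commutantI:
  "T \<in> bounded_ops \<Longrightarrow> (\<And>S \<xi>. S \<in> A \<Longrightarrow> blinfun_apply S (blinfun_apply T \<xi>) = blinfun_apply T (blinfun_apply S \<xi>))
    \<Longrightarrow> T \<in> commutant A"
  unfolding commutant_def by (auto intro: blinfun_eqI)

lemma commutantD:
  assumes "T \<in> commutant A" "S \<in> A"
  shows "blinfun_apply S (blinfun_apply T \<xi>) = blinfun_apply T (blinfun_apply S \<xi>)"
proof -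
  have "S o\<^sub>L T = T o\<^sub>L S"
    using assms unfolding commutant_def by blast
  then have "blinfun_apply (S o\<^sub>L T) \<xi> = blinfun_apply (T o\<^sub>L S) \<xi>"
    by simp
  then show ?thesis
    by simp
qed

lemma commutant_bounded: "T \<in> commutant A \<Longrightarrow> T \<in> bounded_ops"
  unfolding commutant_def by blast

lemma commutant_antimono: "A \<subseteq> B \<Longrightarrow> commutant B \<subseteq> commutant A"
  unfolding commutant_def by blast

text \<open>
  A bounded increasing net of self-adjoint operators converges strongly (Vigier). On each vector
  the quadratic forms converge because they are monotone and bounded, and for \<open>d \<le> e\<close> the
  inequality above bounds \<open>\<parallel>(e - d)\<xi>\<parallel>\<^sup>2\<close> by the increment of the form. The limit is the supremum
  among all operators; being a strong limit, it commutes with whatever commutes with the net.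
\<close>

lemma exists_lub_of_bounded_directed:
  fixes D :: "'h::complex_hilbert op set"
  assumes D: "directed_sa A D" and A: "A \<subseteq> bounded_ops"
    and b: "b \<in> bounded_ops" "\<And>d. d \<in> D \<Longrightarrow> op_le d b"
  shows "\<exists>r\<in>commutant (commutant D). is_lub_in bounded_ops D r"
proof -
  obtain d\<^sub>0 where d0: "d\<^sub>0 \<in> D"
    using D by (auto simp: directed_sa_def)
  have DB: "d \<in> bounded_ops" if "d \<in> D" for d
    using D A that by (auto simp: directed_sa_def)
  have dir: "\<exists>c\<in>D. op_le d c \<and> op_le e c" if "d \<in> D" "e \<in> D" for d e
    using D that by (auto simp: directed_sa_def)
  define up where "up d = {e \<in> D. op_le d e}" for d
  \<comment> \<open>Convergence along the directed set is convergence along its filter of tails.\<close>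
  define F where "F = (INF d\<in>D. principal (up d))"
  have ev: "eventually P F \<longleftrightarrow> (\<exists>d\<in>D. \<forall>e\<in>up d. P e)" for P
    unfolding F_def
  proof (subst eventually_INF_base)
    show "D \<noteq> {}"
      using d0 by blast
    fix d e assume "d \<in> D" "e \<in> D"
    then obtain c where "c \<in> D" "op_le d c" "op_le e c"
      using dir by blast
    then show "\<exists>c\<in>D. principal (up c) \<le> inf (principal (up d)) (principal (up e))"
      by (intro bexI[of _ c]) (auto simp: up_def intro: op_le_trans)
  qed (simp add: eventually_principal)
  have self: "d \<in> up d" if "d \<in> D" for d
    using that by (simp add: up_def op_le_refl)
  have F: "F \<noteq> bot"
    using ev[of "\<lambda>_. False"] self by (auto simp: trivial_limit_def)
  let ?q = "\<lambda>d \<xi>. Re (cinner (blinfun_apply d \<xi>) \<xi>)"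
  let ?C = "norm (b - d\<^sub>0)"
  have diff: "e - d \<in> bounded_ops" "op_pos (e - d)" "op_le (e - d) (b - d\<^sub>0)"
    if "d \<in> up d\<^sub>0" "e \<in> up d" for d e
  proof -
    show "e - d \<in> bounded_ops" "op_pos (e - d)"
      using that DB bounded_ops_diff by (auto simp: up_def op_le_def)
    have "op_pos ((b - e) + (d - d\<^sub>0))"
      using that b(2) by (intro op_pos_add) (auto simp: up_def op_le_def)
    then show "op_le (e - d) (b - d\<^sub>0)"
      by (simp add: op_le_def algebra_simps)
  qed
  have "\<exists>l. ((\<lambda>d. blinfun_apply d \<xi>) \<longlongrightarrow> l) F" for \<xi>
  proof -
    define a where "a = (SUP d\<in>D. ?q d \<xi>)"
    have bdd: "bdd_above ((\<lambda>d. ?q d \<xi>) ` D)"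
      using b(2) by (intro bdd_aboveI[of _ "?q b \<xi>"]) (auto intro: op_le_Re)
    have "\<exists>P. eventually P F \<and> (\<forall>x y. P x \<and> P y \<longrightarrow> dist (blinfun_apply x \<xi>) (blinfun_apply y \<xi>) < e)"
      if "0 < e" for e
    proof -
      \<comment> \<open>The quadratic form is to be within this distance of its supremum; \<open>+ 1\<close> keeps the denominator positive.\<close>
      have e: "0 < (e/2)\<^sup>2 / (?C + 1)"
        using that by (simp add: add_nonneg_pos)
      then have "a - (e/2)\<^sup>2 / (?C + 1) < a"
        by linarith
      then obtain d\<^sub>1 where d1: "d\<^sub>1 \<in> D" "a - (e/2)\<^sup>2 / (?C + 1) < ?q d\<^sub>1 \<xi>"
        unfolding a_def using less_cSUP_iff[OF _ bdd] d0 by blast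
      obtain d where d: "d \<in> D" "op_le d\<^sub>0 d" "op_le d\<^sub>1 d"
        using dir[OF d0 d1(1)] by blast
      have near: "norm (blinfun_apply x \<xi> - blinfun_apply d \<xi>) < e/2" if "x \<in> up d" for x
      proof -
        have "d \<in> up d\<^sub>0"
          using d by (simp add: up_def)
        note xd = diff[OF this that]
        have "?q x \<xi> \<le> a"
          unfolding a_def using that by (intro cSUP_upper bdd) (simp add: up_def)
        moreover have "?q d\<^sub>1 \<xi> \<le> ?q d \<xi>"
          by (rule op_le_Re[OF d(3)])
        ultimately have inc: "?q (x - d) \<xi> \<le> (e/2)\<^sup>2 / (?C + 1)"
          using d1 by (simp add: blinfun.diff_left cinner_diff_left)
        have "(norm (blinfun_apply (x - d) \<xi>))\<^sup>2 \<le> ?C * ?q (x - d) \<xi>"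
          by (rule norm_sq_positive_le[OF xd])
        also have "\<dots> \<le> ?C * ((e/2)\<^sup>2 / (?C + 1))"
          by (intro mult_left_mono inc) simp
        also have "\<dots> < (?C + 1) * ((e/2)\<^sup>2 / (?C + 1))"
          using e by (intro mult_strict_right_mono) auto
        also have "\<dots> = (e/2)\<^sup>2"
          by (simp add: add_nonneg_eq_0_iff)
        finally show ?thesis
          using \<open>0 < e\<close> power_less_imp_less_base[of _ 2 "e/2"] by (simp add: blinfun.diff_left)
      qed
      show ?thesis
      proof (intro exI conjI allI impI)
        show "eventually (\<lambda>x. x \<in> up d) F"
          unfolding ev using d(1) by blast
        fix x y assume "x \<in> up d \<and> y \<in> up d"
        then have "dist (blinfun_apply x \<xi>) (blinfun_apply d \<xi>) < e/2"
            "dist (blinfun_apply y \<xi>) (blinfun_apply d \<xi>) < e/2"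
          using near by (simp_all add: dist_norm)
        then show "dist (blinfun_apply x \<xi>) (blinfun_apply y \<xi>) < e"
          by (rule dist_triangle_half_l)
      qed
    qed
    then have "cauchy_filter (filtermap (\<lambda>d. blinfun_apply d \<xi>) F)"
      by (simp add: cauchy_filter_metric_filtermap)
    then show ?thesis
      unfolding filterlim_def
      by (rule cauchy_filter_complete_converges[OF _ complete_UNIV])
        (use F in \<open>simp_all add: filtermap_bot_iff\<close>)
  qed
  then obtain r where r: "\<And>\<xi>. ((\<lambda>d. blinfun_apply d \<xi>) \<longlongrightarrow> r \<xi>) F"
    by metis
  note uniq = tendsto_unique[OF F]
  have evD: "eventually (\<lambda>d. d \<in> D) F"
    unfolding ev using d0 by (auto simp: up_def)
  have add: "r (x + y) = r x + r y" for x y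
    by (rule uniq[OF r]) (simp add: blinfun.add_right tendsto_add r)
  have scale: "r (c *\<^sub>C x) = c *\<^sub>C r x" for c x
  proof (rule uniq[OF r])
    show "((\<lambda>d. blinfun_apply d (c *\<^sub>C x)) \<longlongrightarrow> c *\<^sub>C r x) F"
      by (rule Lim_transform_eventually[OF tendsto_scaleC[OF r[of x]]], rule eventually_mono[OF evD])
        (simp add: bounded_ops_scaleC DB)
  qed
  have bound: "norm (r x) \<le> norm x * (norm d\<^sub>0 + ?C)" for x
  proof (rule tendsto_upperbound[OF tendsto_norm[OF r] _ F])
    have "norm (blinfun_apply d x) \<le> norm x * (norm d\<^sub>0 + ?C)" if "d \<in> up d\<^sub>0" for d
    proof -
      have "norm (blinfun_apply d x) \<le> norm (blinfun_apply d\<^sub>0 x) + norm (blinfun_apply (d - d\<^sub>0) x)"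
        by (metis add.commute blinfun.diff_left norm_triangle_sub)
      also have "\<dots> \<le> norm d\<^sub>0 * norm x + ?C * norm x"
        using diff[OF self[OF d0] that] by (intro add_mono norm_blinfun norm_positive_le)
      finally show ?thesis
        by (simp add: algebra_simps)
    qed
    then show "eventually (\<lambda>d. norm (blinfun_apply d x) \<le> norm x * (norm d\<^sub>0 + ?C)) F"
      unfolding ev using d0 by blast
  qed
  have "bounded_linear r"
    using add scale[of "complex_of_real _"] bound
    by (intro bounded_linear_intro[where K = "norm d\<^sub>0 + ?C"]) (simp_all add: scaleC_of_real)
  then have app: "blinfun_apply (Blinfun r) = r"
    by (rule bounded_linear_Blinfun_apply)
  have R: "Blinfun r \<in> bounded_ops"
    by (rule bounded_opsI) (simp add: app scale)
  have form: "((\<lambda>d. cinner (blinfun_apply d \<xi>) \<xi>) \<longlongrightarrow> cinner (r \<xi>) \<xi>) F" for \<xi>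
    by (intro tendsto_cinner r tendsto_const)
  have Im0: "Im (cinner (blinfun_apply d \<xi>) \<xi>) = 0" if "d \<in> D" for d \<xi>
    using D that op_adj_eq_self_iff[OF DB[OF that]] by (auto simp: directed_sa_def)
  have Imr: "Im (cinner (r \<xi>) \<xi>) = 0" for \<xi>
  proof (rule uniq[OF tendsto_Im[OF form]])
    show "((\<lambda>d. Im (cinner (blinfun_apply d \<xi>) \<xi>)) \<longlongrightarrow> 0) F"
      by (rule tendsto_eventually, rule eventually_mono[OF evD]) (rule Im0)
  qed
  have upper: "op_le d (Blinfun r)" if "d \<in> D" for d
    unfolding op_le_def op_pos_def
  proof (intro allI conjI)
    fix \<xi>
    show "Im (cinner (blinfun_apply (Blinfun r - d) \<xi>) \<xi>) = 0"
      by (simp add: app blinfun.diff_left cinner_diff_left Imr Im0[OF that])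
    have "eventually (\<lambda>e. ?q d \<xi> \<le> ?q e \<xi>) F"
      unfolding ev using that op_le_Re by (intro bexI[of _ d]) (auto simp: up_def)
    then have "?q d \<xi> \<le> Re (cinner (r \<xi>) \<xi>)"
      by (rule tendsto_lowerbound[OF tendsto_Re[OF form] _ F])
    then show "0 \<le> Re (cinner (blinfun_apply (Blinfun r - d) \<xi>) \<xi>)"
      by (simp add: app blinfun.diff_left cinner_diff_left)
  qed
  have least: "op_le (Blinfun r) t" if t: "\<forall>d\<in>D. op_le d t" for t
    unfolding op_le_def op_pos_def
  proof (intro allI conjI)
    fix \<xi>
    have "Im (cinner (blinfun_apply (t - d\<^sub>0) \<xi>) \<xi>) = 0"
      using t d0 op_pos_Im by (auto simp: op_le_def)
    then show "Im (cinner (blinfun_apply (t - Blinfun r) \<xi>) \<xi>) = 0"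
      by (simp add: app blinfun.diff_left cinner_diff_left Imr Im0[OF d0])
    have "eventually (\<lambda>e. ?q e \<xi> \<le> ?q t \<xi>) F"
      using t op_le_Re by (intro eventually_mono[OF evD]) blast
    then have "Re (cinner (r \<xi>) \<xi>) \<le> ?q t \<xi>"
      by (rule tendsto_upperbound[OF tendsto_Re[OF form] _ F])
    then show "0 \<le> Re (cinner (blinfun_apply (t - Blinfun r) \<xi>) \<xi>)"
      by (simp add: app blinfun.diff_left cinner_diff_left)
  qed
  have "Blinfun r \<in> commutant (commutant D)"
  proof (rule commutantI[OF R])
    fix T \<xi> assume T: "T \<in> commutant D"
    show "blinfun_apply T (blinfun_apply (Blinfun r) \<xi>) = blinfun_apply (Blinfun r) (blinfun_apply T \<xi>)"
      unfolding app
    proof (rule uniq[OF _ r])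
      have "((\<lambda>d. blinfun_apply T (blinfun_apply d \<xi>)) \<longlongrightarrow> blinfun_apply T (r \<xi>)) F"
        by (intro blinfun.tendsto tendsto_const r)
      then show "((\<lambda>d. blinfun_apply d (blinfun_apply T \<xi>)) \<longlongrightarrow> blinfun_apply T (r \<xi>)) F"
        by (rule Lim_transform_eventually, intro eventually_mono[OF evD]) (simp add: commutantD[OF T])
    qed
  qed
  then show ?thesis
    using R upper least by (auto simp: is_lub_in_def)
qed

section \<open>Von Neumann algebras\<close>

lemma commutant_closed:
  shows "id_blinfun \<in> commutant A"
    and "S \<in> commutant A \<Longrightarrow> T \<in> commutant A \<Longrightarrow> S + T \<in> commutant A"
    and "S \<in> commutant A \<Longrightarrow> T \<in> commutant A \<Longrightarrow> S o\<^sub>L T \<in> commutant A"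
    and "A \<subseteq> bounded_ops \<Longrightarrow> T \<in> commutant A \<Longrightarrow> op_scale c T \<in> commutant A"
proof -
  show "id_blinfun \<in> commutant A"
    by (intro commutantI bounded_ops_id) simp
next
  assume S: "S \<in> commutant A" and T: "T \<in> commutant A"
  note comm = commutantD[OF S] commutantD[OF T] and B = commutant_bounded[OF S] commutant_bounded[OF T]
  show "S + T \<in> commutant A"
    by (intro commutantI bounded_ops_add B) (simp add: blinfun.add_left blinfun.add_right comm)
  show "S o\<^sub>L T \<in> commutant A"
    by (intro commutantI bounded_ops_compose B) (simp add: comm)
next
  assume A: "A \<subseteq> bounded_ops" and T: "T \<in> commutant A"
  show "op_scale c T \<in> commutant A"
  proof (intro commutantI bounded_ops_scale commutant_bounded[OF T])
    fix S \<xi> assume S: "S \<in> A"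
    then show "blinfun_apply S (blinfun_apply (op_scale c T) \<xi>) = blinfun_apply (op_scale c T) (blinfun_apply S \<xi>)"
      using bounded_ops_scaleC[of S] A commutantD[OF T S] by (simp add: op_scale_apply subset_iff)
  qed
qed

lemma von_neumann_algebra_closed:
  assumes A: "von_neumann_algebra A"
  shows "x \<in> A \<Longrightarrow> x \<in> bounded_ops"
    and "x \<in> A \<Longrightarrow> op_adj x \<in> A"
    and "id_blinfun \<in> A"
    and "x \<in> A \<Longrightarrow> y \<in> A \<Longrightarrow> x + y \<in> A"
    and "x \<in> A \<Longrightarrow> y \<in> A \<Longrightarrow> x o\<^sub>L y \<in> A"
    and "x \<in> A \<Longrightarrow> op_scale c x \<in> A"
    and "x \<in> A \<Longrightarrow> r *\<^sub>R x \<in> A"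
    and "x \<in> A \<Longrightarrow> y \<in> A \<Longrightarrow> x - y \<in> A"
    and "0 \<in> A"
proof -
  have eq: "commutant (commutant A) = A" and sub: "commutant A \<subseteq> bounded_ops"
    using A by (auto simp: von_neumann_algebra_def commutant_def)
  note c = commutant_closed[where A = "commutant A", unfolded eq]
  show "x \<in> A \<Longrightarrow> x \<in> bounded_ops" "x \<in> A \<Longrightarrow> op_adj x \<in> A"
    using A by (auto simp: von_neumann_algebra_def)
  show id: "id_blinfun \<in> A"
    by (rule c)
  show add: "x \<in> A \<Longrightarrow> y \<in> A \<Longrightarrow> x + y \<in> A" for x y
    by (rule c)
  show "x \<in> A \<Longrightarrow> y \<in> A \<Longrightarrow> x o\<^sub>L y \<in> A"
    by (rule c)
  show scale: "x \<in> A \<Longrightarrow> op_scale c x \<in> A" for x c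
    by (rule c(4)[OF sub])
  show scaleR: "x \<in> A \<Longrightarrow> r *\<^sub>R x \<in> A" for x r
    using scale[of x "complex_of_real r"] by (simp add: op_scale_of_real)
  show "x \<in> A \<Longrightarrow> y \<in> A \<Longrightarrow> x - y \<in> A"
    using add[of x "- y"] scaleR[of y "-1"] by simp
  show "0 \<in> A"
    using scaleR[OF id, of 0] by simp
qed

text \<open>
  The supremum among all bounded operators lies in the bicommutant of the net, hence in \<open>A\<close>. So the
  supremum of a directed set is the same in every von Neumann algebra that contains the set and its
  supremum.
\<close>

lemma is_lub_in_von_neumann_iff:
  assumes A: "von_neumann_algebra A" and D: "directed_sa A D"
  shows "is_lub_in A D s \<longleftrightarrow> s \<in> A \<and> is_lub_in bounded_ops D s"
proof
  note cl = von_neumann_algebra_closed[OF A]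
  assume s: "is_lub_in A D s"
  then have sA: "s \<in> A" and ub: "\<And>d. d \<in> D \<Longrightarrow> op_le d s"
    by (auto simp: is_lub_in_def)
  have sub: "A \<subseteq> bounded_ops" and DA: "D \<subseteq> A"
    using cl(1) D by (auto simp: directed_sa_def)
  obtain r where r: "r \<in> commutant (commutant D)" "is_lub_in bounded_ops D r"
    using exists_lub_of_bounded_directed[OF D sub cl(1)[OF sA] ub] by blast
  have "commutant (commutant D) \<subseteq> A"
    using commutant_antimono[OF commutant_antimono[OF DA]] A by (simp add: von_neumann_algebra_def)
  with r have rA: "r \<in> A"
    by blast
  have "op_le r s" "op_le s r"
    using s r rA cl(1) by (auto simp: is_lub_in_def)
  then have "r = s"
    using sA rA cl(1) by (intro op_le_antisym) auto
  then show "s \<in> A \<and> is_lub_in bounded_ops D s"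
    using r sA by simp
next
  assume "s \<in> A \<and> is_lub_in bounded_ops D s"
  then show "is_lub_in A D s"
    using von_neumann_algebra_closed(1)[OF A] by (auto simp: is_lub_in_def)
qed

lemma exists_lub_in_von_neumann:
  assumes A: "von_neumann_algebra A" and D: "directed_sa A D"
    and b: "b \<in> bounded_ops" "\<And>d. d \<in> D \<Longrightarrow> op_le d b"
  shows "\<exists>r\<in>A. is_lub_in bounded_ops D r"
proof -
  have "A \<subseteq> bounded_ops" and DA: "D \<subseteq> A"
    using von_neumann_algebra_closed(1)[OF A] D by (auto simp: directed_sa_def)
  then obtain r where r: "r \<in> commutant (commutant D)" "is_lub_in bounded_ops D r"
    using exists_lub_of_bounded_directed[OF D _ b] by blast
  moreover have "commutant (commutant D) \<subseteq> A"
    using commutant_antimono[OF commutant_antimono[OF DA]] A by (simp add: von_neumann_algebra_def)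
  ultimately show ?thesis
    by blast
qed

lemma directed_sa_mono: "directed_sa A D \<Longrightarrow> A \<subseteq> B \<Longrightarrow> directed_sa B D"
  by (auto simp: directed_sa_def)

section \<open>Unital completely positive maps\<close>

text \<open>
  Positivity is complete positivity for \<open>1 \<times> 1\<close> matrices.
\<close>

lemma ucp_map_pos:
  assumes \<Phi>: "ucp_map A B \<Phi>" and x: "x \<in> A" "op_pos x"
  shows "op_pos (\<Phi> x)"
proof -
  have "matrix_pos 1 (\<lambda>i j. x)"
    using x(2) by (simp add: matrix_pos_def op_pos_def Let_def)
  then have "matrix_pos 1 (\<lambda>i j. \<Phi> x)"
    using \<Phi> x(1) unfolding ucp_map_def by meson
  then have "let q = cinner (blinfun_apply (\<Phi> x) \<xi>) \<xi> in Im q = 0 \<and> 0 \<le> Re q" for \<xi>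
    unfolding matrix_pos_def by (auto dest!: spec[of _ "\<lambda>_. \<xi>"])
  then show ?thesis
    by (simp add: op_pos_def Let_def)
qed

locale ucp =
  fixes A B :: "'h::complex_hilbert op set" and \<Phi> :: "'h op \<Rightarrow> 'h op"
  assumes A: "von_neumann_algebra A" and B: "von_neumann_algebra B" and \<Phi>: "ucp_map A B \<Phi>"
begin

lemma \<Phi>_in: "x \<in> A \<Longrightarrow> \<Phi> x \<in> B"
  and \<Phi>_add: "x \<in> A \<Longrightarrow> y \<in> A \<Longrightarrow> \<Phi> (x + y) = \<Phi> x + \<Phi> y"
  and \<Phi>_scale: "x \<in> A \<Longrightarrow> \<Phi> (op_scale c x) = op_scale c (\<Phi> x)"
  and \<Phi>_id: "\<Phi> id_blinfun = id_blinfun"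
  using \<Phi> by (auto simp: ucp_map_def)

lemmas A_closed = von_neumann_algebra_closed[OF A]

lemma \<Phi>_scaleR: "x \<in> A \<Longrightarrow> \<Phi> (r *\<^sub>R x) = r *\<^sub>R \<Phi> x"
  using \<Phi>_scale[of x "complex_of_real r"] by (simp add: op_scale_of_real)

lemma \<Phi>_diff:
  assumes "x \<in> A" "y \<in> A"
  shows "\<Phi> (x - y) = \<Phi> x - \<Phi> y"
  using \<Phi>_add[of x "- y"] \<Phi>_scaleR[of y "-1"] A_closed(7)[of y "-1"] assms by simp

lemma \<Phi>_bounded: "x \<in> A \<Longrightarrow> \<Phi> x \<in> bounded_ops"
  using \<Phi>_in von_neumann_algebra_closed(1)[OF B] by blast

lemma \<Phi>_mono: "x \<in> A \<Longrightarrow> y \<in> A \<Longrightarrow> op_le x y \<Longrightarrow> op_le (\<Phi> x) (\<Phi> y)"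
  unfolding op_le_def using ucp_map_pos[OF \<Phi>, of "y - x"] by (simp add: A_closed \<Phi>_diff)

text \<open>
  Apply positivity of \<open>\<Phi>\<close> on \<open>2 \<times> 2\<close> matrices to the matrix with entries \<open>1\<close>, \<open>x\<close>, \<open>x\<^sup>*\<close>,
  \<open>x\<^sup>*x\<close>, which is positive since its quadratic form is \<open>\<parallel>\<xi> + x\<eta>\<parallel>\<^sup>2\<close>.
\<close>

lemma two_positivity:
  assumes x: "x \<in> A"
  defines "q \<xi> \<eta> \<equiv> cinner \<xi> \<xi> + cinner (blinfun_apply (\<Phi> x) \<eta>) \<xi> +
      cinner (blinfun_apply (\<Phi> (op_adj x)) \<xi>) \<eta> + cinner (blinfun_apply (\<Phi> (op_adj x o\<^sub>L x)) \<eta>) \<eta>"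
  shows "Im (q \<xi> \<eta>) = 0" "0 \<le> Re (q \<xi> \<eta>)"
proof -
  define m where "m i j = (if i = (0::nat) then if j = (0::nat) then id_blinfun else x
      else if j = 0 then op_adj x else op_adj x o\<^sub>L x)" for i j
  have mA: "\<forall>i<2. \<forall>j<2. m i j \<in> A"
    by (auto simp: m_def x A_closed)
  have sum2: "(\<Sum>i<(2::nat). f i) = f 0 + f 1" for f :: "nat \<Rightarrow> complex"
    by (simp add: numeral_2_eq_2)
  have "matrix_pos 2 m"
    unfolding matrix_pos_def
  proof
    fix \<xi> :: "nat \<Rightarrow> 'h"
    have "(\<Sum>i<2. \<Sum>j<2. cinner (blinfun_apply (m i j) (\<xi> j)) (\<xi> i)) =
        cinner (\<xi> 0 + blinfun_apply x (\<xi> 1)) (\<xi> 0 + blinfun_apply x (\<xi> 1))"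
      by (simp add: sum2 m_def cinner_add_left cinner_add_right cinner_op_adj(2)[OF A_closed(1)[OF x]])
    then show "let q = \<Sum>i<2. \<Sum>j<2. cinner (blinfun_apply (m i j) (\<xi> j)) (\<xi> i) in Im q = 0 \<and> 0 \<le> Re q"
      by (simp add: cinner_self)
  qed
  then have pos: "matrix_pos 2 (\<lambda>i j. \<Phi> (m i j))"
    using \<Phi> mA unfolding ucp_map_def by meson
  have "(\<Sum>i<2. \<Sum>j<2. cinner (blinfun_apply (\<Phi> (m i j)) (if j = 0 then \<xi> else \<eta>)) (if i = 0 then \<xi> else \<eta>)) = q \<xi> \<eta>"
    by (simp add: sum2 m_def q_def \<Phi>_id)
  then show "Im (q \<xi> \<eta>) = 0" "0 \<le> Re (q \<xi> \<eta>)"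
    using pos[unfolded matrix_pos_def, THEN spec, of "\<lambda>i. if i = 0 then \<xi> else \<eta>"]
    by (simp_all add: Let_def)
qed

text \<open>
  The off-diagonal part of the form in \<open>two_positivity\<close> is real. Comparing it at \<open>\<xi>\<close> and at
  \<open>\<i> \<xi>\<close> shows that its two terms are conjugate to each other.
\<close>

lemma \<Phi>_adj:
  assumes x: "x \<in> A"
  shows "op_adj (\<Phi> x) = \<Phi> (op_adj x)"
proof (rule op_adj_eqI)
  fix \<eta> \<xi> :: 'h
  have xx: "Im (cinner (blinfun_apply (\<Phi> (op_adj x o\<^sub>L x)) \<eta>) \<eta>) = 0"
    by (intro op_pos_Im ucp_map_pos[OF \<Phi>] op_pos_adj_compose A_closed x)
  have im: "Im (cinner (blinfun_apply (\<Phi> x) \<eta>) \<zeta>) + Im (cinner (blinfun_apply (\<Phi> (op_adj x)) \<zeta>) \<eta>) = 0" for \<zeta>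
    using two_positivity(1)[OF x, of \<zeta> \<eta>] xx by (simp add: cinner_self)
  have "\<Phi> (op_adj x) \<in> bounded_ops"
    by (intro \<Phi>_bounded A_closed x)
  note scale = bounded_ops_scaleC[OF this]
  have "cinner (blinfun_apply (\<Phi> x) \<eta>) \<xi> = cnj (cinner (blinfun_apply (\<Phi> (op_adj x)) \<xi>) \<eta>)"
    using im[of \<xi>] im[of "\<i> *\<^sub>C \<xi>"]
    by (simp add: complex_eq_iff scale cinner_scaleC_left cinner_scaleC_right)
  then show "cinner (blinfun_apply (\<Phi> x) \<eta>) \<xi> = cinner \<eta> (blinfun_apply (\<Phi> (op_adj x)) \<xi>)"
    by (simp flip: cinner_commute)
qed

text \<open>
  Put \<open>\<xi> = - \<Phi>(x)\<eta>\<close> in \<open>two_positivity\<close>: the first two terms cancel and the third is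
  \<open>- \<parallel>\<Phi>(x)\<eta>\<parallel>\<^sup>2\<close>.
\<close>

lemma Schwarz_inequality:
  assumes x: "x \<in> A"
  shows "op_le (op_adj (\<Phi> x) o\<^sub>L \<Phi> x) (\<Phi> (op_adj x o\<^sub>L x))"
  unfolding op_le_def op_pos_def
proof (intro allI)
  fix \<eta>
  let ?v = "blinfun_apply (\<Phi> x) \<eta>"
  have eq: "cinner (blinfun_apply (\<Phi> (op_adj x o\<^sub>L x) - (op_adj (\<Phi> x) o\<^sub>L \<Phi> x)) \<eta>) \<eta> =
      cinner (- ?v) (- ?v) + cinner ?v (- ?v) +
      cinner (blinfun_apply (\<Phi> (op_adj x)) (- ?v)) \<eta> + cinner (blinfun_apply (\<Phi> (op_adj x o\<^sub>L x)) \<eta>) \<eta>"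
    by (simp add: \<Phi>_adj[OF x, symmetric] blinfun.diff_left blinfun.minus_right cinner_diff_left
        cinner_minus_left cinner_minus_right)
  show "Im (cinner (blinfun_apply (\<Phi> (op_adj x o\<^sub>L x) - (op_adj (\<Phi> x) o\<^sub>L \<Phi> x)) \<eta>) \<eta>) = 0 \<and>
      0 \<le> Re (cinner (blinfun_apply (\<Phi> (op_adj x o\<^sub>L x) - (op_adj (\<Phi> x) o\<^sub>L \<Phi> x)) \<eta>) \<eta>)"
    using two_positivity[OF x, of "- ?v" \<eta>] by (simp only: eq) 
qed

text \<open>
  Combine the Schwarz inequality with \<open>x\<^sup>*x \<le> \<parallel>x\<parallel>\<^sup>2 1\<close> and unitality.
\<close>

lemma \<Phi>_norm_le:
  assumes x: "x \<in> A"
  shows "norm (\<Phi> x) \<le> norm x"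
proof (rule norm_blinfun_bound)
  fix \<xi>
  let ?r = "(norm x)\<^sup>2"
  have xx: "op_adj x o\<^sub>L x \<in> A" and r: "?r *\<^sub>R id_blinfun \<in> A"
    by (simp_all add: A_closed x)
  have "op_le (op_adj x o\<^sub>L x) (?r *\<^sub>R id_blinfun)"
    unfolding op_le_def op_pos_def
  proof (intro allI conjI)
    fix \<zeta>
    have eq: "cinner (blinfun_apply (?r *\<^sub>R id_blinfun - (op_adj x o\<^sub>L x)) \<zeta>) \<zeta> =
        complex_of_real ((norm x * norm \<zeta>)\<^sup>2 - (norm (blinfun_apply x \<zeta>))\<^sup>2)"
      by (simp add: blinfun.diff_left blinfun.scaleR_left cinner_diff_left cinner_scaleR_left
          cinner_op_adj(2)[OF A_closed(1)[OF x]] cinner_self scaleR_conv_of_real power_mult_distrib)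
    show "Im (cinner (blinfun_apply (?r *\<^sub>R id_blinfun - (op_adj x o\<^sub>L x)) \<zeta>) \<zeta>) = 0"
      "0 \<le> Re (cinner (blinfun_apply (?r *\<^sub>R id_blinfun - (op_adj x o\<^sub>L x)) \<zeta>) \<zeta>)"
      unfolding eq by (simp_all add: power_mono norm_blinfun)
  qed
  from op_le_trans[OF Schwarz_inequality[OF x] \<Phi>_mono[OF xx r this]]
  have "op_le (op_adj (\<Phi> x) o\<^sub>L \<Phi> x) (?r *\<^sub>R id_blinfun)"
    by (simp add: \<Phi>_scaleR A_closed \<Phi>_id)
  from op_le_Re[OF this, of \<xi>] have "(norm (blinfun_apply (\<Phi> x) \<xi>))\<^sup>2 \<le> (norm x * norm \<xi>)\<^sup>2"
    by (simp add: cinner_op_adj(2)[OF \<Phi>_bounded[OF x]] Re_cinner_self blinfun.scaleR_left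
        cinner_scaleR_left power_mult_distrib)
  then show "norm (blinfun_apply (\<Phi> x) \<xi>) \<le> norm x * norm \<xi>"
    by (rule power2_le_imp_le) simp
qed simp

lemma directed_sa_image:
  assumes "directed_sa A D"
  shows "directed_sa B (\<Phi> ` D)"
proof -
  have D: "D \<noteq> {}" "D \<subseteq> A" "\<And>d. d \<in> D \<Longrightarrow> op_adj d = d"
      "\<And>a b. a \<in> D \<Longrightarrow> b \<in> D \<Longrightarrow> \<exists>c\<in>D. op_le a c \<and> op_le b c"
    using assms by (auto simp: directed_sa_def)
  show ?thesis
    unfolding directed_sa_def
  proof (intro conjI ballI)
    show "\<Phi> ` D \<noteq> {}" "\<Phi> ` D \<subseteq> B"
      using D \<Phi>_in by auto
    show "op_adj d = d" if "d \<in> \<Phi> ` D" for d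
      using that D by (auto simp: \<Phi>_adj subset_iff)
    show "\<exists>c\<in>\<Phi> ` D. op_le a c \<and> op_le b c" if ab: "a \<in> \<Phi> ` D" "b \<in> \<Phi> ` D" for a b
    proof -
      obtain a' b' where *: "a' \<in> D" "b' \<in> D" "a = \<Phi> a'" "b = \<Phi> b'"
        using ab by blast
      then obtain c where "c \<in> D" "op_le a' c" "op_le b' c"
        using D(4) by blast
      with * D(2) \<Phi>_mono show ?thesis
        by blast
    qed
  qed
qed

end

lemma ucp_map_compose: "ucp_map A B \<Phi> \<Longrightarrow> ucp_map B C \<Psi> \<Longrightarrow> ucp_map A C (\<lambda>x. \<Psi> (\<Phi> x))"
  unfolding ucp_map_def by simp

lemma ucp_map_restrict: "ucp_map A B \<Phi> \<Longrightarrow> A' \<subseteq> A \<Longrightarrow> ucp_map A' B \<Phi>"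
  unfolding ucp_map_def by (simp add: subset_iff)

section \<open>Extension of densely defined contractions\<close>

text \<open>
  The closure of the graph \<open>G\<close> is again the graph of a linear contraction, and completeness makes
  it defined on the whole closure of the domain.
\<close>

lemma contraction_extension:
  fixes G :: "('k::complex_hilbert \<times> 'k) set"
  assumes zero: "(0, 0) \<in> G"
    and add: "\<And>v w v' w'. (v, w) \<in> G \<Longrightarrow> (v', w') \<in> G \<Longrightarrow> (v + v', w + w') \<in> G"
    and scale: "\<And>c v w. (v, w) \<in> G \<Longrightarrow> (c *\<^sub>C v, c *\<^sub>C w) \<in> G"
    and bound: "\<And>v w. (v, w) \<in> G \<Longrightarrow> norm w \<le> norm v"
  shows "\<exists>T. T o\<^sub>L ortho_proj (closure (fst ` G)) = T \<and> (\<forall>(v, w)\<in>G. blinfun_apply T v = w)"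
proof -
  let ?S = "closure (fst ` G)"
  let ?C = "closure G"
  have diff: "(v - v', w - w') \<in> G" if "(v, w) \<in> G" "(v', w') \<in> G" for v w v' w'
    using add[OF that(1) scale[OF that(2), of "-1"]] by (simp add: scaleC_minus_one)
  have addC: "(v + v', w + w') \<in> ?C" if "(v, w) \<in> ?C" "(v', w') \<in> ?C" for v w v' w'
  proof -
    obtain f where f: "\<And>n. f n \<in> G" "f \<longlonglongrightarrow> (v, w)"
      using \<open>(v, w) \<in> ?C\<close> by (auto simp: closure_sequential)
    obtain g where g: "\<And>n. g n \<in> G" "g \<longlonglongrightarrow> (v', w')"
      using \<open>(v', w') \<in> ?C\<close> by (auto simp: closure_sequential)
    have "f n + g n \<in> G" for n
      using add[of "fst (f n)" "snd (f n)" "fst (g n)" "snd (g n)"] f(1)[of n] g(1)[of n]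
      by (simp add: plus_prod_def)
    then show ?thesis
      using tendsto_add[OF f(2) g(2)] unfolding closure_sequential
      by (intro exI[of _ "\<lambda>n. f n + g n"]) simp
  qed
  have scaleC: "(c *\<^sub>C v, c *\<^sub>C w) \<in> ?C" if vw: "(v, w) \<in> ?C" for c v w
  proof -
    obtain f where f: "\<And>n. f n \<in> G" "f \<longlonglongrightarrow> (v, w)"
      using vw by (auto simp: closure_sequential)
    have "(c *\<^sub>C fst (f n), c *\<^sub>C snd (f n)) \<in> G" for n
      using scale[of "fst (f n)" "snd (f n)"] f(1)[of n] by simp
    moreover have "(\<lambda>n. (c *\<^sub>C fst (f n), c *\<^sub>C snd (f n))) \<longlonglongrightarrow> (c *\<^sub>C v, c *\<^sub>C w)"
      using tendsto_fst[OF f(2)] tendsto_snd[OF f(2)]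
      by (intro tendsto_Pair tendsto_scaleC) simp_all
    ultimately show ?thesis
      unfolding closure_sequential by (intro exI[of _ "\<lambda>n. (c *\<^sub>C fst (f n), c *\<^sub>C snd (f n))"]) blast
  qed
  have boundC: "norm w \<le> norm v" if "(v, w) \<in> ?C" for v w
  proof -
    have "closed {p :: 'k \<times> 'k. norm (snd p) \<le> norm (fst p)}"
      by (intro closed_Collect_le continuous_intros)
    then have "?C \<subseteq> {p. norm (snd p) \<le> norm (fst p)}"
      using bound by (intro closure_minimal) auto
    then show ?thesis
      using that by auto
  qed
  have unique: "w = w'" if "(v, w) \<in> ?C" "(v, w') \<in> ?C" for v w w'
    using boundC[OF addC[OF that(1) scaleC[OF that(2), of "-1"]]] by (simp add: scaleC_minus_one)
  have total: "\<exists>w. (v, w) \<in> ?C" if v: "v \<in> ?S" for v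
  proof -
    obtain f where f: "\<And>n. f n \<in> fst ` G" "f \<longlonglongrightarrow> v"
      using v unfolding closure_sequential by blast
    then have "\<exists>w. (f n, w) \<in> G" for n
      by (metis imageE prod.collapse)
    then obtain g where g: "\<And>n. (f n, g n) \<in> G"
      by metis
    \<comment> \<open>A contraction maps Cauchy sequences of its domain to Cauchy sequences.\<close>
    have "Cauchy g"
    proof (rule metric_CauchyI)
      fix e :: real assume "0 < e"
      then obtain K where K: "\<forall>m\<ge>K. \<forall>n\<ge>K. dist (f m) (f n) < e"
        using LIMSEQ_imp_Cauchy[OF f(2)] unfolding Cauchy_def by blast
      have "dist (g m) (g n) \<le> dist (f m) (f n)" for m n
        unfolding dist_norm by (rule bound[OF diff[OF g g]])
      with K show "\<exists>K. \<forall>m\<ge>K. \<forall>n\<ge>K. dist (g m) (g n) < e"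
        by (meson order_le_less_trans)
    qed
    then obtain w where "g \<longlonglongrightarrow> w"
      by (meson Cauchy_convergent convergent_def)
    with f(2) have "(\<lambda>n. (f n, g n)) \<longlonglongrightarrow> (v, w)"
      by (rule tendsto_Pair)
    with g show ?thesis
      unfolding closure_sequential by (intro exI[of _ w] exI[of _ "\<lambda>n. (f n, g n)"]) blast
  qed
  have sub: "complex_subspace (fst ` G)"
    unfolding complex_subspace_def
  proof (intro conjI ballI allI)
    show "0 \<in> fst ` G"
      using imageI[OF zero, of fst] by simp
    show "v + v' \<in> fst ` G" if v: "v \<in> fst ` G" "v' \<in> fst ` G" for v v'
    proof -
      obtain w w' where "(v, w) \<in> G" "(v', w') \<in> G"
        using v by auto
      from imageI[OF add[OF this], of fst] show ?thesis
        by simp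
    qed
    show "c *\<^sub>C v \<in> fst ` G" if v: "v \<in> fst ` G" for c v
    proof -
      obtain w where "(v, w) \<in> G"
        using v by auto
      from imageI[OF scale[OF this], of fst] show ?thesis
        by simp
    qed
  qed
  define p where "p = ortho_proj ?S"
  note proj = ortho_proj_characterization[OF closed_closure complex_subspace_closure[OF sub], folded p_def]
  have proj_id: "blinfun_apply p v = v" if "v \<in> ?S" for v
    unfolding p_def
    by (rule ortho_proj_eqI[OF closed_closure complex_subspace_closure[OF sub] that]) simp
  obtain t where t: "\<And>v. v \<in> ?S \<Longrightarrow> (v, t v) \<in> ?C"
    using total by metis
  define T where "T \<xi> = t (blinfun_apply p \<xi>)" for \<xi>
  have T: "(blinfun_apply p \<xi>, T \<xi>) \<in> ?C" for \<xi>
    unfolding T_def by (rule t[OF proj(2)])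
  have "bounded_linear T"
  proof (rule bounded_linear_intro)
    fix x y :: 'k and r :: real
    show "T (x + y) = T x + T y"
      by (rule unique[OF T]) (simp add: blinfun.add_right addC T)
    show "T (r *\<^sub>R x) = r *\<^sub>R T x"
      by (rule unique[OF T]) (use scaleC[OF T[of x], of "complex_of_real r"] in
          \<open>simp add: blinfun.scaleR_right scaleC_of_real\<close>)
    show "norm (T x) \<le> norm x * norm p"
      by (rule order_trans[OF boundC[OF T]]) (metis mult.commute norm_blinfun)
  qed
  then have app: "blinfun_apply (Blinfun T) = T"
    by (rule bounded_linear_Blinfun_apply)
  show ?thesis
  proof (intro exI[of _ "Blinfun T"] conjI ballI, unfold split_beta)
    show "Blinfun T o\<^sub>L ortho_proj ?S = Blinfun T"
      by (rule blinfun_eqI) (simp add: app T_def proj_id[OF proj(2)] flip: p_def)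
    fix vw assume vw: "vw \<in> G"
    then have "fst vw \<in> ?S" "(fst vw, snd vw) \<in> ?C"
      using closure_subset by (fastforce, force)
    then show "blinfun_apply (Blinfun T) (fst vw) = snd vw"
      using unique[OF T] by (simp add: app proj_id)
  qed
qed

section \<open>Conditional expectations in the GNS representation\<close>

lemma normal_mapD:
  "normal_map A B \<Phi> \<Longrightarrow> directed_sa A D \<Longrightarrow> is_lub_in A D s \<Longrightarrow> is_lub_in B (\<Phi> ` D) (\<Phi> s)"
  unfolding normal_map_def by blast

locale gns =
  fixes M :: "'h::complex_hilbert op set"
    and \<phi> :: "'h op \<Rightarrow> complex"
    and \<pi> :: "'h op \<Rightarrow> 'k::complex_hilbert op"
    and \<Omega> :: 'k
  assumes M: "von_neumann_algebra M"
    and state: "faithful_normal_state M \<phi>"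
    and rep: "gns_representation M \<phi> \<pi> \<Omega>"
begin

abbreviation ket :: "'h op \<Rightarrow> 'k" where
  "ket x \<equiv> blinfun_apply (\<pi> x) \<Omega>"

abbreviation expected :: "'h op set set" where
  "expected \<equiv> expected_subalgebras M \<phi>"

abbreviation E :: "'h op set \<Rightarrow> 'h op \<Rightarrow> 'h op" where
  "E \<equiv> the_expectation M \<phi>"

abbreviation e :: "'h op set \<Rightarrow> 'k op" where
  "e \<equiv> jones_proj \<pi> \<Omega>"

lemmas M_closed = von_neumann_algebra_closed[OF M]

lemma
  shows \<pi>_bounded: "x \<in> M \<Longrightarrow> \<pi> x \<in> bounded_ops"
    and \<pi>_add: "x \<in> M \<Longrightarrow> y \<in> M \<Longrightarrow> \<pi> (x + y) = \<pi> x + \<pi> y"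
    and \<pi>_scale: "x \<in> M \<Longrightarrow> \<pi> (op_scale c x) = op_scale c (\<pi> x)"
    and \<pi>_mult: "x \<in> M \<Longrightarrow> y \<in> M \<Longrightarrow> \<pi> (x o\<^sub>L y) = \<pi> x o\<^sub>L \<pi> y"
    and \<pi>_adj: "x \<in> M \<Longrightarrow> \<pi> (op_adj x) = op_adj (\<pi> x)"
    and \<phi>_eq: "x \<in> M \<Longrightarrow> \<phi> x = cinner (ket x) \<Omega>"
    and kets_dense: "closure (ket ` M) = UNIV"
  using rep by (simp_all add: gns_representation_def)

lemma ket_add: "x \<in> M \<Longrightarrow> y \<in> M \<Longrightarrow> ket (x + y) = ket x + ket y"
  by (simp add: \<pi>_add blinfun.add_left)

lemma ket_scale: "x \<in> M \<Longrightarrow> ket (op_scale c x) = c *\<^sub>C ket x"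
  by (simp add: \<pi>_scale op_scale_apply)

lemma ket_diff:
  assumes "x \<in> M" "y \<in> M"
  shows "ket (x - y) = ket x - ket y"
  using ket_add[of "x - y" y] M_closed(8)[of x y] assms by simp

lemma ket_mult: "x \<in> M \<Longrightarrow> y \<in> M \<Longrightarrow> ket (x o\<^sub>L y) = blinfun_apply (\<pi> x) (ket y)"
  by (simp add: \<pi>_mult)

lemma cinner_ket:
  assumes "x \<in> M" "y \<in> M"
  shows "cinner (ket x) (ket y) = \<phi> (op_adj y o\<^sub>L x)"
  using assms by (simp add: \<phi>_eq M_closed \<pi>_mult \<pi>_adj cinner_op_adj(2)[OF \<pi>_bounded])

lemma norm_ket_sq: "x \<in> M \<Longrightarrow> (norm (ket x))\<^sup>2 = Re (\<phi> (op_adj x o\<^sub>L x))"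
  by (simp flip: cinner_ket add: Re_cinner_self)

lemma norm2_eq: "x \<in> M \<Longrightarrow> norm2 \<phi> x = norm (ket x)"
  by (simp add: norm2_def flip: norm_ket_sq)

lemma \<phi>_diff: "x \<in> M \<Longrightarrow> y \<in> M \<Longrightarrow> \<phi> (x - y) = \<phi> x - \<phi> y"
  by (simp add: \<phi>_eq M_closed ket_diff cinner_diff_left)

lemma \<phi>_mono: "x \<in> M \<Longrightarrow> y \<in> M \<Longrightarrow> op_le x y \<Longrightarrow> Re (\<phi> x) \<le> Re (\<phi> y)"
  using state M_closed(8)[of y x] \<phi>_diff[of y x]
  unfolding faithful_normal_state_def op_le_def by force

lemma \<phi>_faithful: "x \<in> M \<Longrightarrow> op_pos x \<Longrightarrow> Re (\<phi> x) = 0 \<Longrightarrow> x = 0"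
  using state unfolding faithful_normal_state_def by (metis complex_eqI zero_complex.sel)

lemma \<phi>_normal: "directed_sa M D \<Longrightarrow> is_lub_in M D s \<Longrightarrow> Re (\<phi> s) = (SUP d\<in>D. Re (\<phi> d))"
  using state unfolding faithful_normal_state_def normal_functional_def by blast

lemma ket_eq_0D:
  assumes x: "x \<in> M" and 0: "ket x = 0"
  shows "x = 0"
proof -
  have "op_adj x o\<^sub>L x = 0"
    using norm_ket_sq[OF x] 0 by (intro \<phi>_faithful) (simp_all add: M_closed op_pos_adj_compose x)
  then have "cinner (blinfun_apply (op_adj x o\<^sub>L x) \<xi>) \<xi> = 0" for \<xi>
    by simp
  then have "blinfun_apply x \<xi> = 0" for \<xi>
    by (simp add: cinner_op_adj(2)[OF M_closed(1)[OF x]] cinner_self)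
  then show ?thesis
    by (intro blinfun_eqI) simp
qed

lemma eq_on_ketsI:
  assumes "\<And>x. x \<in> M \<Longrightarrow> blinfun_apply S (ket x) = blinfun_apply T (ket x)"
  shows "S = T"
proof (rule blinfun_eqI)
  fix \<xi>
  have "closed {v. blinfun_apply S v = blinfun_apply T v}"
    by (intro closed_Collect_eq continuous_intros)
  then have "closure (ket ` M) \<subseteq> {v. blinfun_apply S v = blinfun_apply T v}"
    using assms by (intro closure_minimal) auto
  then show "blinfun_apply S \<xi> = blinfun_apply T \<xi>"
    using kets_dense by auto
qed

text \<open>
  \<open>\<parallel>\<Phi>(x)\<parallel>\<^sub>2\<^sup>2 = \<phi>(\<Phi>(x)\<^sup>*\<Phi>(x)) \<le> \<phi>(\<Phi>(x\<^sup>*x)) \<le> \<phi>(x\<^sup>*x)\<close> by the Schwarz inequality. This covers both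
  the expectations and the approximating maps.
\<close>

lemma ucp_ket_contraction:
  assumes "ucp A B \<Phi>" and AM: "A \<subseteq> M" and BM: "B \<subseteq> M" and x: "x \<in> A"
    and le: "\<And>y. y \<in> A \<Longrightarrow> op_pos y \<Longrightarrow> Re (\<phi> (\<Phi> y)) \<le> Re (\<phi> y)"
  shows "norm (ket (\<Phi> x)) \<le> norm (ket x)"
proof -
  interpret ucp A B \<Phi>
    by (rule assms(1))
  have x': "x \<in> M" "\<Phi> x \<in> M" "op_adj x o\<^sub>L x \<in> A"
    using x AM BM by (auto intro: \<Phi>_in A_closed)
  have "Re (\<phi> (op_adj (\<Phi> x) o\<^sub>L \<Phi> x)) \<le> Re (\<phi> (\<Phi> (op_adj x o\<^sub>L x)))"
    using x' BM by (intro \<phi>_mono Schwarz_inequality[OF x]) (auto intro: M_closed \<Phi>_in)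
  also have "\<dots> \<le> Re (\<phi> (op_adj x o\<^sub>L x))"
    using x' by (intro le op_pos_adj_compose M_closed)
  finally have "(norm (ket (\<Phi> x)))\<^sup>2 \<le> (norm (ket x))\<^sup>2"
    by (simp add: norm_ket_sq x')
  then show ?thesis
    by simp
qed

context
  fixes N assumes N: "N \<in> expected"
begin

lemma expected_vN: "von_neumann_algebra N"
  and expected_subset: "N \<subseteq> M"
  using N by (auto simp: expected_subalgebras_def)

lemma expected_in: "x \<in> N \<Longrightarrow> x \<in> M"
  using expected_subset by blast

lemma E_preserving: "preserving_expectation M \<phi> N (E N)"
proof -
  have "\<exists>F. preserving_expectation M \<phi> N F"
    using N by (simp add: expected_subalgebras_def)
  then show ?thesis
    unfolding the_expectation_def by (rule someI_ex)
qed

lemma E_ucp: "ucp M N (E N)"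
  using E_preserving M expected_vN
  by (simp add: ucp_def preserving_expectation_def conditional_expectation_def)

lemma E_id: "x \<in> N \<Longrightarrow> E N x = x"
  and E_bimodular: "bimodular N M (E N)"
  and \<phi>_E: "x \<in> M \<Longrightarrow> \<phi> (E N x) = \<phi> x"
  using E_preserving by (simp_all add: preserving_expectation_def conditional_expectation_def)

lemma E_in: "x \<in> M \<Longrightarrow> E N x \<in> N"
  by (rule ucp.\<Phi>_in[OF E_ucp])

lemma E_in_M: "x \<in> M \<Longrightarrow> E N x \<in> M"
  by (rule expected_in[OF E_in])

lemma E_mult_left: "a \<in> N \<Longrightarrow> x \<in> M \<Longrightarrow> E N (a o\<^sub>L x) = a o\<^sub>L E N x"
proof -
  assume a: "a \<in> N" and x: "x \<in> M"
  have "y o\<^sub>L id_blinfun = y" for y :: "'h op"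
    by (rule blinfun_eqI) simp
  then show "E N (a o\<^sub>L x) = a o\<^sub>L E N x"
    using bspec[OF bspec[OF bspec[OF E_bimodular[unfolded bimodular_def] a]] x, of id_blinfun]
      von_neumann_algebra_closed(3)[OF expected_vN] by simp
qed

lemma E_mult_right: "b \<in> N \<Longrightarrow> x \<in> M \<Longrightarrow> E N (x o\<^sub>L b) = E N x o\<^sub>L b"
proof -
  assume b: "b \<in> N" and x: "x \<in> M"
  have "id_blinfun o\<^sub>L y = y" for y :: "'h op"
    by (rule blinfun_eqI) simp
  then show "E N (x o\<^sub>L b) = E N x o\<^sub>L b"
    using bspec[OF bspec[OF bspec[OF E_bimodular[unfolded bimodular_def]] b] x, of id_blinfun]
      von_neumann_algebra_closed(3)[OF expected_vN] by simp
qed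

lemma norm_ket_E: "x \<in> M \<Longrightarrow> norm (ket (E N x)) \<le> norm (ket x)"
  by (rule ucp_ket_contraction[OF E_ucp _ expected_subset]) (simp_all add: \<phi>_E)

text \<open>
  For \<open>y \<in> N\<close> one has \<open>\<phi>(y\<^sup>*E(x)) = \<phi>(E(y\<^sup>*x)) = \<phi>(y\<^sup>*x)\<close>; this is why \<open>E\<close> becomes an orthogonal
  projection on \<open>L\<^sup>2\<close>.
\<close>

lemma cinner_ket_E:
  assumes x: "x \<in> M" and y: "y \<in> N"
  shows "cinner (ket (E N x)) (ket y) = cinner (ket x) (ket y)"
proof -
  have y': "op_adj y \<in> N" "y \<in> M" "op_adj y \<in> M"
    using y von_neumann_algebra_closed(2)[OF expected_vN] expected_subset by auto
  have "\<phi> (op_adj y o\<^sub>L E N x) = \<phi> (op_adj y o\<^sub>L x)"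
    using \<phi>_E[of "op_adj y o\<^sub>L x"] by (simp add: E_mult_left y' x M_closed)
  then show ?thesis
    by (simp add: cinner_ket E_in_M x y')
qed

lemma complex_subspace_kets: "complex_subspace (ket ` N)"
proof -
  note cl = von_neumann_algebra_closed[OF expected_vN]
  have "ket 0 = 0"
    using ket_diff[of 0 0] M_closed by simp
  then have "0 \<in> ket ` N"
    using cl(9) by (metis image_eqI)
  moreover have "v + w \<in> ket ` N" if "v \<in> ket ` N" "w \<in> ket ` N" for v w
    using that expected_in by (auto simp flip: ket_add intro!: imageI cl)
  moreover have "c *\<^sub>C v \<in> ket ` N" if "v \<in> ket ` N" for v c
    using that expected_in by (auto simp flip: ket_scale intro!: imageI cl)
  ultimately show ?thesis
    by (simp add: complex_subspace_def)
qed

lemma L2_closed_subspace: "closed (L2 \<pi> \<Omega> N)" "complex_subspace (L2 \<pi> \<Omega> N)"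
  unfolding L2_def by (rule closed_closure, rule complex_subspace_closure[OF complex_subspace_kets])

lemma jones_bounded: "e N \<in> bounded_ops"
  unfolding jones_proj_def by (rule ortho_proj_characterization[OF L2_closed_subspace])

lemma jones_ket:
  assumes x: "x \<in> M"
  shows "blinfun_apply (e N) (ket x) = ket (E N x)"
  unfolding jones_proj_def
proof (rule ortho_proj_eqI[OF L2_closed_subspace])
  show "ket (E N x) \<in> L2 \<pi> \<Omega> N"
    unfolding L2_def by (rule subsetD[OF closure_subset imageI[OF E_in[OF x]]])
  have "closed {\<zeta>. cinner (ket x - ket (E N x)) \<zeta> = 0}"
    by (intro closed_Collect_eq continuous_on_cinner continuous_on_const continuous_on_id)
  then have "L2 \<pi> \<Omega> N \<subseteq> {\<zeta>. cinner (ket x - ket (E N x)) \<zeta> = 0}"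
    unfolding L2_def by (intro closure_minimal) (auto simp: cinner_diff_left cinner_ket_E x)
  then show "cinner (ket x - ket (E N x)) \<zeta> = 0" if "\<zeta> \<in> L2 \<pi> \<Omega> N" for \<zeta>
    using that by blast
qed

lemma jones_idem: "e N o\<^sub>L e N = e N"
  by (rule eq_on_ketsI) (simp add: jones_ket E_in E_in_M E_id)

text \<open>
  Normality is forced by the state: the supremum \<open>r\<close> of \<open>E D\<close> lies below \<open>E s\<close>, and
  \<open>\<phi> r = sup \<phi> (E d) = sup \<phi> d = \<phi> s = \<phi> (E s)\<close> by normality of \<open>\<phi>\<close>, so faithfulness gives
  \<open>r = E s\<close>.
\<close>

lemma E_normal: "normal_map M N (E N)"
  unfolding normal_map_def
proof (intro allI impI, elim conjE)
  fix D s assume D: "directed_sa M D" and s: "is_lub_in M D s"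
  interpret E: ucp M N "E N"
    by (rule E_ucp)
  have DM: "D \<subseteq> M" and sM: "s \<in> M" and ub: "\<And>d. d \<in> D \<Longrightarrow> op_le d s"
    using D s by (auto simp: directed_sa_def is_lub_in_def)
  have ED: "directed_sa N (E N ` D)"
    by (rule E.directed_sa_image[OF D])
  have EDM: "directed_sa M (E N ` D)"
    by (rule directed_sa_mono[OF ED expected_subset])
  have Eub: "op_le d (E N s)" if "d \<in> E N ` D" for d
    using that DM sM ub E.\<Phi>_mono by blast
  obtain r where r: "r \<in> N" "is_lub_in bounded_ops (E N ` D) r"
    using exists_lub_in_von_neumann[OF expected_vN ED E.\<Phi>_bounded[OF sM] Eub] by blast
  have rM: "r \<in> M" "E N s \<in> M"
    using r E_in_M sM expected_in by auto
  have lub: "is_lub_in M (E N ` D) r"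
    using r rM is_lub_in_von_neumann_iff[OF M EDM] by blast
  have le: "op_le r (E N s)"
    using lub Eub rM by (auto simp: is_lub_in_def)
  have "Re (\<phi> r) = (SUP d\<in>E N ` D. Re (\<phi> d))"
    by (rule \<phi>_normal[OF EDM lub])
  also have "\<dots> = (SUP d\<in>D. Re (\<phi> d))"
    unfolding image_image using DM by (intro SUP_cong) (auto simp: \<phi>_E)
  also have "\<dots> = Re (\<phi> (E N s))"
    by (simp add: \<phi>_normal[OF D s] \<phi>_E[OF sM])
  finally have "Re (\<phi> (E N s - r)) = 0"
    by (simp add: \<phi>_diff rM)
  then have "E N s - r = 0"
    using le rM by (intro \<phi>_faithful M_closed) (auto simp: op_le_def)
  then show "is_lub_in N (E N ` D) (E N s)"
    using r is_lub_in_von_neumann_iff[OF expected_vN ED] by simp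
qed

end

text \<open>
  Both sides lie in \<open>P\<close> and have the same inner products with \<open>P\<close> as \<open>x\<close>.
\<close>

lemma E_tower:
  assumes P: "P \<in> expected" and N: "N \<in> expected" and PN: "P \<subseteq> N" and x: "x \<in> M"
  shows "E P (E N x) = E P x"
proof -
  let ?w = "E P (E N x) - E P x"
  have in_M: "E N x \<in> M" "E P x \<in> M" "E P (E N x) \<in> M"
    using assms by (simp_all add: E_in_M)
  have wP: "?w \<in> P"
    using assms in_M by (intro von_neumann_algebra_closed(8)[OF expected_vN[OF P]] E_in)
  have "cinner (ket ?w) (ket y) = 0" if "y \<in> P" for y
    using that PN by (simp add: ket_diff in_M cinner_diff_left cinner_ket_E P N x subset_iff)
  then have "ket ?w = 0"
    using wP Re_cinner_self[of "ket ?w"] by simp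
  then have "?w = 0"
    by (rule ket_eq_0D[OF M_closed(8)[OF in_M(3,2)]])
  then show ?thesis
    by simp
qed

section \<open>Compression of relatively compact operators\<close>

text \<open>
  On \<open>x\<Omega>\<close> this is \<open>E\<^sub>N(a E\<^sub>P(x)) = E\<^sub>N(a) E\<^sub>P(x)\<close>, which holds because \<open>E\<^sub>P(x) \<in> N\<close>.
\<close>

lemma jones_compress_left:
  assumes P: "P \<in> expected" and N: "N \<in> expected" and PN: "P \<subseteq> N" and a: "a \<in> M"
  shows "e N o\<^sub>L \<pi> a o\<^sub>L e P = \<pi> (E N a) o\<^sub>L e P"
proof (rule eq_on_ketsI)
  fix x assume x: "x \<in> M"
  have "E P x \<in> N"
    using E_in[OF P x] PN by blast
  then show "blinfun_apply (e N o\<^sub>L \<pi> a o\<^sub>L e P) (ket x) = blinfun_apply (\<pi> (E N a) o\<^sub>L e P) (ket x)"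
    by (simp add: jones_ket E_mult_right E_in_M M_closed P N x a flip: ket_mult)
qed

text \<open>
  The tower property lets \<open>E\<^sub>P\<close> absorb first \<open>E\<^sub>N\<^sub>'\<close>, after \<open>b\<close> has been moved inside it, and then
  introduce \<open>E\<^sub>N\<close>, out of which \<open>E\<^sub>N(x)\<close> is moved to the right.
\<close>

lemma jones_compress_right:
  assumes P: "P \<in> expected" and N: "N \<in> expected" and N': "N' \<in> expected"
    and PN: "P \<subseteq> N" and PN': "P \<subseteq> N'" and b: "b \<in> N'"
  shows "e P o\<^sub>L \<pi> b o\<^sub>L e N' o\<^sub>L e N = e P o\<^sub>L \<pi> (E N b) o\<^sub>L e N"
proof (rule eq_on_ketsI)
  fix x assume x: "x \<in> M"
  have in_M: "b \<in> M" "E N x \<in> M" "E N b \<in> M" "E N' (E N x) \<in> M" "b o\<^sub>L E N x \<in> M"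
    using assms x by (auto intro: E_in_M M_closed expected_in)
  have "E P (b o\<^sub>L E N' (E N x)) = E P (E N' (b o\<^sub>L E N x))"
    by (simp add: E_mult_left N' b in_M)
  also have "\<dots> = E P (E N (b o\<^sub>L E N x))"
    by (simp add: E_tower P N N' PN PN' in_M)
  also have "\<dots> = E P (E N b o\<^sub>L E N x)"
    by (simp add: E_mult_right N E_in x in_M)
  finally show "blinfun_apply (e P o\<^sub>L \<pi> b o\<^sub>L e N' o\<^sub>L e N) (ket x) =
      blinfun_apply (e P o\<^sub>L \<pi> (E N b) o\<^sub>L e N) (ket x)"
    by (simp add: jones_ket P N N' x in_M M_closed flip: ket_mult)
qed

text \<open>
  On a generator, \<open>e\<^sub>N (a e\<^sub>P b) e\<^sub>N = E\<^sub>N(a) e\<^sub>P E\<^sub>N(b)\<close> by the two preceding identities; the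
  compression is linear and norm continuous.
\<close>

lemma relative_compacts_compress:
  assumes P: "P \<in> expected" and N: "N \<in> expected" and N': "N' \<in> expected"
    and PN: "P \<subseteq> N" and PN': "P \<subseteq> N'" and T: "T \<in> relative_compacts \<pi> \<Omega> N' P"
  shows "e N o\<^sub>L T o\<^sub>L e N \<in> relative_compacts \<pi> \<Omega> N P"
proof -
  define G where "G N = {\<pi> x o\<^sub>L e P o\<^sub>L \<pi> y o\<^sub>L e N | x y. x \<in> N \<and> y \<in> N}" for N
  define f where "f T = e N o\<^sub>L T o\<^sub>L e N" for T
  have fG: "f s \<in> G N" if sG: "s \<in> G N'" for s
  proof -
    obtain x y where s: "s = \<pi> x o\<^sub>L e P o\<^sub>L \<pi> y o\<^sub>L e N'" and xy: "x \<in> N'" "y \<in> N'"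
      using sG unfolding G_def by blast
    have "f s = (e N o\<^sub>L \<pi> x o\<^sub>L e P) o\<^sub>L \<pi> y o\<^sub>L e N' o\<^sub>L e N"
      unfolding f_def s by (rule blinfun_eqI) simp
    also have "\<dots> = \<pi> (E N x) o\<^sub>L (e P o\<^sub>L \<pi> y o\<^sub>L e N' o\<^sub>L e N)"
      unfolding jones_compress_left[OF P N PN expected_in[OF N' xy(1)]] by (rule blinfun_eqI) simp
    also have "\<dots> = \<pi> (E N x) o\<^sub>L e P o\<^sub>L \<pi> (E N y) o\<^sub>L e N"
      unfolding jones_compress_right[OF P N N' PN PN' xy(2)] by (rule blinfun_eqI) simp
    finally show ?thesis
      unfolding G_def using E_in[OF N] expected_in[OF N'] xy by blast
  qed
  have f_sum: "f (\<Sum>i<n. op_scale (c i) (s i)) = (\<Sum>i<n. op_scale (c i) (f (s i)))"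
    for n :: nat and c s
    by (rule blinfun_eqI)
      (simp add: f_def blinfun.sum_left blinfun.sum_right op_scale_apply
        bounded_ops_scaleC[OF jones_bounded[OF N]])
  have "f ` op_cspan (G N') \<subseteq> op_cspan (G N)"
  proof
    fix z assume "z \<in> f ` op_cspan (G N')"
    then obtain n :: nat and c s where z: "z = f (\<Sum>i<n. op_scale (c i) (s i))" and s: "\<forall>i<n. s i \<in> G N'"
      unfolding op_cspan_def by blast
    have "z = (\<Sum>i<n. op_scale (c i) (f (s i)))" "\<forall>i<n. f (s i) \<in> G N"
      using s fG by (auto simp: z f_sum)
    then show "z \<in> op_cspan (G N)"
      unfolding op_cspan_def by (intro CollectI exI conjI)
  qed
  then have "f ` closure (op_cspan (G N')) \<subseteq> closure (op_cspan (G N))"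
    unfolding f_def
    by (intro image_closure_subset closed_closure
        bounded_bilinear.continuous_on[OF bounded_bilinear_blinfun_compose] continuous_intros)
      (use closure_subset in blast)
  then show ?thesis
    using T unfolding relative_compacts_def f_def G_def by blast
qed

text \<open>
  An operator with \<open>T e\<^sub>N = T\<close> is determined by its values on \<open>N\<Omega>\<close>, since \<open>T x\<Omega> = T E\<^sub>N(x)\<Omega>\<close> on the
  dense subspace \<open>M\<Omega>\<close>.
\<close>

lemma hat_op_eqI:
  assumes N: "N \<in> expected" and T: "T o\<^sub>L e N = T"
    and app: "\<And>x. x \<in> N \<Longrightarrow> blinfun_apply T (ket x) = ket (\<Phi> x)"
  shows "hat_op \<pi> \<Omega> N \<Phi> = T"
  unfolding hat_op_def
proof (rule the_equality)
  show "T o\<^sub>L e N = T \<and> (\<forall>x\<in>N. blinfun_apply T (ket x) = ket (\<Phi> x))"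
    using T app by blast
  fix S assume S: "S o\<^sub>L e N = S \<and> (\<forall>x\<in>N. blinfun_apply S (ket x) = ket (\<Phi> x))"
  show "S = T"
  proof (rule eq_on_ketsI)
    fix x assume x: "x \<in> M"
    have "blinfun_apply R (ket x) = ket (\<Phi> (E N x))"
      if "R o\<^sub>L e N = R" "\<And>x. x \<in> N \<Longrightarrow> blinfun_apply R (ket x) = ket (\<Phi> x)" for R
      using that(2)[OF E_in[OF N x]] jones_ket[OF N x]
      by (metis that(1) blinfun_apply_blinfun_compose)
    then show "blinfun_apply S (ket x) = blinfun_apply T (ket x)"
      using S T app by metis
  qed
qed

text \<open>
  The map \<open>x\<Omega> \<mapsto> \<Phi>(x)\<Omega>\<close> is a contraction on \<open>N\<Omega>\<close>, hence extends to \<open>L\<^sup>2(N)\<close>, and by zero to the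
  whole space. So the description in the definition of \<open>hat_op\<close> does denote an operator.
\<close>

lemma hat_op_ket:
  assumes N: "N \<in> expected" and \<Phi>: "ucp_map N N \<Phi>"
    and le: "\<And>y. y \<in> N \<Longrightarrow> op_pos y \<Longrightarrow> Re (\<phi> (\<Phi> y)) \<le> Re (\<phi> y)"
  shows "hat_op \<pi> \<Omega> N \<Phi> o\<^sub>L e N = hat_op \<pi> \<Omega> N \<Phi>"
    and "x \<in> N \<Longrightarrow> blinfun_apply (hat_op \<pi> \<Omega> N \<Phi>) (ket x) = ket (\<Phi> x)"
proof -
  interpret ucp N N \<Phi>
    using expected_vN[OF N] \<Phi> by unfold_locales
  note in_M = expected_in[OF N]
  define G where "G = (\<lambda>x. (ket x, ket (\<Phi> x))) ` N"
  have GI: "(ket x, ket (\<Phi> x)) \<in> G" if "x \<in> N" for x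
    using that by (simp add: G_def)
  have fst_G: "fst ` G = ket ` N"
    by (auto simp: G_def image_image)
  have "\<exists>T. T o\<^sub>L ortho_proj (closure (fst ` G)) = T \<and> (\<forall>(v, w)\<in>G. blinfun_apply T v = w)"
  proof (rule contraction_extension)
    have "ket 0 = 0" "\<Phi> 0 = 0"
      using ket_diff[of 0 0] \<Phi>_diff[of 0 0] M_closed A_closed by simp_all
    then show "(0, 0) \<in> G"
      using GI[of 0] A_closed by simp
    show "(v + v', w + w') \<in> G" if vw: "(v, w) \<in> G" "(v', w') \<in> G" for v w v' w'
    proof -
      obtain x y where xy: "x \<in> N" "y \<in> N" "v = ket x" "w = ket (\<Phi> x)" "v' = ket y" "w' = ket (\<Phi> y)"
        using vw by (auto simp: G_def)
      then show ?thesis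
        using GI[of "x + y"] by (simp add: A_closed \<Phi>_add \<Phi>_in in_M ket_add)
    qed
    show "(c *\<^sub>C v, c *\<^sub>C w) \<in> G" if vw: "(v, w) \<in> G" for c v w
    proof -
      obtain x where "x \<in> N" "v = ket x" "w = ket (\<Phi> x)"
        using vw by (auto simp: G_def)
      then show ?thesis
        using GI[of "op_scale c x"] by (simp add: A_closed \<Phi>_scale \<Phi>_in in_M ket_scale)
    qed
    show "norm w \<le> norm v" if "(v, w) \<in> G" for v w
      using that ucp_ket_contraction[OF ucp_axioms expected_subset[OF N] expected_subset[OF N] _ le]
      by (auto simp: G_def)
  qed
  then obtain T where T': "T o\<^sub>L ortho_proj (closure (fst ` G)) = T" "\<forall>(v, w)\<in>G. blinfun_apply T v = w"
    by (elim exE conjE)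
  have T: "T o\<^sub>L e N = T" "\<And>x. x \<in> N \<Longrightarrow> blinfun_apply T (ket x) = ket (\<Phi> x)"
    using T'(1) bspec[OF T'(2) GI] by (simp_all add: fst_G jones_proj_def L2_def)
  have "hat_op \<pi> \<Omega> N \<Phi> = T"
    by (rule hat_op_eqI[OF N T])
  with T show "hat_op \<pi> \<Omega> N \<Phi> o\<^sub>L e N = hat_op \<pi> \<Omega> N \<Phi>"
    and "x \<in> N \<Longrightarrow> blinfun_apply (hat_op \<pi> \<Omega> N \<Phi>) (ket x) = ket (\<Phi> x)"
    by simp_all
qed

section \<open>Compression of approximating maps\<close>

context
  fixes P N N' \<Phi>
  assumes P: "P \<in> expected" and N: "N \<in> expected" and N': "N' \<in> expected"
    and PN: "P \<subseteq> N" and PN': "P \<subseteq> N'"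
    and ucp: "ucp_map N' N' \<Phi>"
begin

lemma compress_ucp: "ucp_map N N (\<lambda>x. E N (\<Phi> (E N' x)))"
proof -
  have "ucp_map N N' (E N')"
    using ucp.\<Phi>[OF E_ucp[OF N']] expected_subset[OF N] ucp_map_restrict by blast
  moreover have "ucp_map N' N (E N)"
    using ucp.\<Phi>[OF E_ucp[OF N]] expected_subset[OF N'] ucp_map_restrict by blast
  ultimately show ?thesis
    using ucp_map_compose[OF ucp_map_compose[OF _ ucp]] by blast
qed

lemma approx_in: "x \<in> N' \<Longrightarrow> \<Phi> x \<in> N'"
  using ucp by (simp add: ucp_map_def)

text \<open>
  Suprema are moved between \<open>N\<close>, \<open>N'\<close> and \<open>M\<close>, where they agree, so that normality of the three maps
  can be chained.
\<close>

lemma compress_normal: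
  assumes normal: "normal_map N' N' \<Phi>"
  shows "normal_map N N (\<lambda>x. E N (\<Phi> (E N' x)))"
  unfolding normal_map_def
proof (intro allI impI, elim conjE)
  fix D s assume D: "directed_sa N D" and s: "is_lub_in N D s"
  interpret \<Phi>: ucp N' N' \<Phi>
    using expected_vN[OF N'] ucp by unfold_locales
  note in_M = directed_sa_mono[OF _ expected_subset]
  have lift: "is_lub_in M D s" if "K \<in> expected" "directed_sa K D" "is_lub_in K D s" for K D s
    using that is_lub_in_von_neumann_iff[OF expected_vN[OF that(1)] that(2)]
      is_lub_in_von_neumann_iff[OF M in_M[OF that(2,1)]] expected_in[OF that(1)] by blast
  have 1: "directed_sa N' (E N' ` D)" "is_lub_in N' (E N' ` D) (E N' s)"
    using ucp.directed_sa_image[OF E_ucp[OF N'] in_M[OF D N]]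
      normal_mapD[OF E_normal[OF N'] in_M[OF D N] lift[OF N D s]] by auto
  have 2: "directed_sa N' (\<Phi> ` E N' ` D)" "is_lub_in N' (\<Phi> ` E N' ` D) (\<Phi> (E N' s))"
    using \<Phi>.directed_sa_image[OF 1(1)] normal_mapD[OF normal 1] by auto
  have "is_lub_in N (E N ` \<Phi> ` E N' ` D) (E N (\<Phi> (E N' s)))"
    by (rule normal_mapD[OF E_normal[OF N] in_M[OF 2(1) N'] lift[OF N' 2]])
  then show "is_lub_in N ((\<lambda>x. E N (\<Phi> (E N' x))) ` D) (E N (\<Phi> (E N' s)))"
    by (simp add: image_image)
qed

lemma compress_bimodular:
  assumes bimod: "bimodular P N' \<Phi>"
  shows "bimodular P N (\<lambda>x. E N (\<Phi> (E N' x)))"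
  unfolding bimodular_def
proof (intro ballI)
  fix a b x assume a: "a \<in> P" and b: "b \<in> P" and x: "x \<in> N"
  have 1: "E N' (a o\<^sub>L x o\<^sub>L b) = a o\<^sub>L E N' x o\<^sub>L b"
    using E_bimodular[OF N'] a b expected_in[OF N x] PN' unfolding bimodular_def by blast
  have 2: "\<Phi> (a o\<^sub>L E N' x o\<^sub>L b) = a o\<^sub>L \<Phi> (E N' x) o\<^sub>L b"
    using bimod a b E_in[OF N' expected_in[OF N x]] unfolding bimodular_def by blast
  have "\<Phi> (E N' x) \<in> M"
    by (intro expected_in[OF N'] approx_in E_in[OF N'] expected_in[OF N x])
  then show "E N (\<Phi> (E N' (a o\<^sub>L x o\<^sub>L b))) = a o\<^sub>L E N (\<Phi> (E N' x)) o\<^sub>L b"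
    unfolding 1 2 using E_bimodular[OF N] a b PN unfolding bimodular_def by blast
qed

context
  assumes le: "\<And>y. y \<in> N' \<Longrightarrow> op_pos y \<Longrightarrow> Re (\<phi> (\<Phi> y)) \<le> Re (\<phi> y)"
begin

lemma compress_\<phi>_le:
  assumes y: "y \<in> N" "op_pos y"
  shows "Re (\<phi> (E N (\<Phi> (E N' y)))) \<le> Re (\<phi> y)"
proof -
  have yM: "y \<in> M"
    by (rule expected_in[OF N y(1)])
  have "\<phi> (E N (\<Phi> (E N' y))) = \<phi> (\<Phi> (E N' y))"
    by (intro \<phi>_E[OF N] expected_in[OF N'] approx_in E_in[OF N'] yM)
  moreover have "Re (\<phi> (\<Phi> (E N' y))) \<le> Re (\<phi> (E N' y))"
    by (intro le E_in[OF N'] yM ucp_map_pos[OF ucp.\<Phi>[OF E_ucp[OF N']]] y)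
  ultimately show ?thesis
    by (simp add: \<phi>_E[OF N' yM])
qed

text \<open>
  The operator of the compressed map is \<open>e\<^sub>N T e\<^sub>N\<close> for the operator \<open>T\<close> of \<open>\<Phi>\<close>; the expectation
  \<open>E\<^sub>N\<^sub>'\<close> in the middle is accounted for by \<open>T = T e\<^sub>N\<^sub>'\<close>.
\<close>

lemma compress_hat:
  assumes "hat_op \<pi> \<Omega> N' \<Phi> \<in> relative_compacts \<pi> \<Omega> N' P"
  shows "hat_op \<pi> \<Omega> N (\<lambda>x. E N (\<Phi> (E N' x))) \<in> relative_compacts \<pi> \<Omega> N P"
proof -
  let ?T = "hat_op \<pi> \<Omega> N' \<Phi>"
  have "hat_op \<pi> \<Omega> N (\<lambda>x. E N (\<Phi> (E N' x))) = e N o\<^sub>L ?T o\<^sub>L e N"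
  proof (rule hat_op_eqI[OF N])
    show "(e N o\<^sub>L ?T o\<^sub>L e N) o\<^sub>L e N = e N o\<^sub>L ?T o\<^sub>L e N"
      by (rule blinfun_eqI) (metis jones_idem[OF N] blinfun_apply_blinfun_compose)
    fix x assume x: "x \<in> N"
    have xM: "x \<in> M"
      by (rule expected_in[OF N x])
    have "blinfun_apply ?T (ket x) = blinfun_apply (?T o\<^sub>L e N') (ket x)"
      by (simp only: hat_op_ket(1)[OF N' ucp le])
    also have "\<dots> = ket (\<Phi> (E N' x))"
      by (simp add: jones_ket[OF N' xM] hat_op_ket(2)[OF N' ucp le] E_in[OF N' xM])
    finally show "blinfun_apply (e N o\<^sub>L ?T o\<^sub>L e N) (ket x) = ket (E N (\<Phi> (E N' x)))"
      using expected_in[OF N' approx_in[OF E_in[OF N' xM]]]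
      by (simp add: jones_ket[OF N] xM E_id[OF N x])
  qed
  then show ?thesis
    using relative_compacts_compress[OF P N N' PN PN' assms] by simp
qed

text \<open>
  Since \<open>x = E\<^sub>N(x)\<close>, the difference is \<open>E\<^sub>N(\<Phi>(E\<^sub>N\<^sub>'(x)) - x)\<close>, and \<open>E\<^sub>N\<close> does not increase
  \<open>\<parallel>\<cdot>\<parallel>\<^sub>2\<close>.
\<close>

lemma compress_close:
  assumes x: "x \<in> N" and 1: "norm2 \<phi> (E N' x - E N x) < \<delta>"
    and 2: "norm2 \<phi> (\<Phi> (E N' x) - E N' x) < \<delta>'"
  shows "norm2 \<phi> (E N (\<Phi> (E N' x)) - x) < \<delta> + \<delta>'"
proof -
  have xM: "x \<in> M"
    by (rule expected_in[OF N x])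
  have y: "E N' x \<in> M" "\<Phi> (E N' x) \<in> M"
    using E_in[OF N' xM] approx_in expected_in[OF N'] by auto
  have "E N (\<Phi> (E N' x)) - x = E N (\<Phi> (E N' x) - x)"
    by (simp add: ucp.\<Phi>_diff[OF E_ucp[OF N]] y xM E_id[OF N x])
  then have "norm2 \<phi> (E N (\<Phi> (E N' x)) - x) = norm (ket (E N (\<Phi> (E N' x) - x)))"
    by (simp add: norm2_eq E_in_M[OF N] M_closed y xM)
  also have "\<dots> \<le> norm (ket (\<Phi> (E N' x) - x))"
    by (intro norm_ket_E[OF N] M_closed y xM)
  also have "\<dots> = norm (ket (\<Phi> (E N' x) - E N' x) + ket (E N' x - E N x))"
    by (simp add: ket_diff y xM E_id[OF N x])
  also have "\<dots> \<le> norm2 \<phi> (\<Phi> (E N' x) - E N' x) + norm2 \<phi> (E N' x - E N x)"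
    using norm_triangle_ineq by (simp add: norm2_eq M_closed y E_in_M[OF N] xM)
  finally show ?thesis
    using 1 2 by simp
qed

end

end

section \<open>Closedness\<close>

lemma topspace_expected: "topspace (expected_topology M \<phi>) = expected"
proof -
  have "N \<in> \<Union> {{N \<in> expected. norm2 \<phi> (E N x - E N\<^sub>0 x) < \<epsilon>} | x N\<^sub>0 \<epsilon>. x \<in> M \<and> N\<^sub>0 \<in> expected \<and> 0 < \<epsilon>}"
    if N: "N \<in> expected" for N
  proof (rule UnionI)
    show "{N' \<in> expected. norm2 \<phi> (E N' 0 - E N 0) < 1} \<in>
        {{N \<in> expected. norm2 \<phi> (E N x - E N\<^sub>0 x) < \<epsilon>} | x N\<^sub>0 \<epsilon>. x \<in> M \<and> N\<^sub>0 \<in> expected \<and> 0 < \<epsilon>}"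
      using N M_closed(9) zero_less_one by blast
    show "N \<in> {N' \<in> expected. norm2 \<phi> (E N' 0 - E N 0) < 1}"
      using N ket_diff[of 0 0] by (simp add: norm2_eq M_closed)
  qed
  then show ?thesis
    unfolding expected_topology_def topology_generated_by_topspace by blast
qed

lemma openin_expected_nbhd:
  assumes "1 \<le> k" "N\<^sub>0 \<in> expected" "0 < \<epsilon>" "\<And>j. j \<in> {1..k::nat} \<Longrightarrow> x j \<in> M"
  shows "openin (expected_topology M \<phi>)
    {N \<in> expected. \<forall>j\<in>{1..k}. norm2 \<phi> (E N (x j) - E N\<^sub>0 (x j)) < \<epsilon>}"
proof -
  have "openin (expected_topology M \<phi>) {N \<in> expected. norm2 \<phi> (E N (x j) - E N\<^sub>0 (x j)) < \<epsilon>}"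
    if "j \<in> {1..k}" for j
    unfolding expected_topology_def by (rule topology_generated_by_Basis) (use assms that in blast)
  then have "openin (expected_topology M \<phi>)
      (\<Inter>j\<in>{1..k}. {N \<in> expected. norm2 \<phi> (E N (x j) - E N\<^sub>0 (x j)) < \<epsilon>})"
    using assms(1) by (intro openin_Inter) auto
  moreover have "(\<Inter>j\<in>{1..k}. {N \<in> expected. norm2 \<phi> (E N (x j) - E N\<^sub>0 (x j)) < \<epsilon>}) =
      {N \<in> expected. \<forall>j\<in>{1..k}. norm2 \<phi> (E N (x j) - E N\<^sub>0 (x j)) < \<epsilon>}"
    using assms(1) by auto
  ultimately show ?thesis
    by simp
qed

text \<open>
  Finite intersections of subbasic neighbourhoods of \<open>N\<close>, all centred at \<open>N\<close> and with one radius,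
  suffice to test whether \<open>N\<close> is a limit of \<open>H\<close>.
\<close>

lemma closedin_expectedI:
  assumes "H \<subseteq> expected"
    and "\<And>N. N \<in> expected \<Longrightarrow>
      (\<And>k x \<epsilon>. 1 \<le> k \<Longrightarrow> (\<And>j. j \<in> {1..k::nat} \<Longrightarrow> x j \<in> M) \<Longrightarrow> 0 < \<epsilon> \<Longrightarrow>
        \<exists>N'\<in>H. \<forall>j\<in>{1..k}. norm2 \<phi> (E N' (x j) - E N (x j)) < \<epsilon>) \<Longrightarrow> N \<in> H"
  shows "closedin (expected_topology M \<phi>) H"
  unfolding closedin_def topspace_expected
proof (intro conjI assms(1))
  show "openin (expected_topology M \<phi>) (expected - H)"
  proof (subst openin_subopen, intro ballI)
    fix N assume N: "N \<in> expected - H"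
    then obtain k :: nat and x and \<epsilon> :: real where k: "1 \<le> k" "\<And>j. j \<in> {1..k} \<Longrightarrow> x j \<in> M" "0 < \<epsilon>"
      and far: "\<not> (\<exists>N'\<in>H. \<forall>j\<in>{1..k}. norm2 \<phi> (E N' (x j) - E N (x j)) < \<epsilon>)"
      using assms(2)[of N] by blast
    let ?U = "{N' \<in> expected. \<forall>j\<in>{1..k}. norm2 \<phi> (E N' (x j) - E N (x j)) < \<epsilon>}"
    have "openin (expected_topology M \<phi>) ?U"
      using openin_expected_nbhd[of k N \<epsilon> x] k N by blast
    moreover have "N \<in> ?U"
    proof -
      have "norm2 \<phi> 0 = 0"
        using ket_diff[of 0 0] by (simp add: norm2_eq M_closed)
      then show ?thesis
        using N k(3) by simp
    qed
    moreover have "?U \<subseteq> expected - H"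
      using far by blast
    ultimately show "\<exists>T. openin (expected_topology M \<phi>) T \<and> N \<in> T \<and> T \<subseteq> expected - H"
      by blast
  qed
qed

text \<open>
  All \<open>E\<^sub>N\<^sub>'\<close> fix \<open>p \<in> P\<close>, so \<open>E\<^sub>N(p)\<close> is at distance \<open>0\<close> from \<open>p\<close>.
\<close>

lemma limit_contains:
  assumes P: "P \<subseteq> M" and N: "N \<in> expected" and H: "\<And>N'. N' \<in> H \<Longrightarrow> N' \<in> expected \<and> P \<subseteq> N'"
    and lim: "\<And>x \<epsilon>. x \<in> M \<Longrightarrow> 0 < \<epsilon> \<Longrightarrow> \<exists>N'\<in>H. norm2 \<phi> (E N' x - E N x) < \<epsilon>"
  shows "P \<subseteq> N"
proof
  fix p assume p: "p \<in> P"
  then have pM: "p \<in> M" "E N p \<in> M"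
    using P E_in_M[OF N] by auto
  have "norm (ket (p - E N p)) < \<epsilon>" if "0 < \<epsilon>" for \<epsilon>
  proof -
    obtain N' where "N' \<in> H" "norm2 \<phi> (E N' p - E N p) < \<epsilon>"
      using lim[OF pM(1) \<open>0 < \<epsilon>\<close>] by blast
    moreover from this have "E N' p = p"
      using H p E_id by blast
    ultimately show ?thesis
      by (simp add: norm2_eq M_closed pM)
  qed
  then have "ket (p - E N p) = 0"
    by (metis less_irrefl norm_ge_zero norm_le_zero_iff not_less)
  then have "p = E N p"
    using ket_eq_0D[OF M_closed(8)[OF pM]] by simp
  then show "p \<in> N"
    using E_in[OF N pM(1)] by simp
qed

text \<open>
  A single \<open>N'\<close> close to \<open>N\<close> on the given elements suffices: its approximating map for the
  contractions \<open>E\<^sub>N\<^sub>'(x\<^sub>j)\<close> is compressed to \<open>N\<close>.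
\<close>

lemma limit_haagerup:
  assumes P: "P \<in> expected" and N: "N \<in> expected" and PN: "P \<subseteq> N"
    and H: "\<And>N'. N' \<in> H \<Longrightarrow> N' \<in> expected \<and> P \<subseteq> N' \<and> relative_haagerup \<phi> \<pi> \<Omega> N' P"
    and lim: "\<And>k x \<epsilon>. 1 \<le> k \<Longrightarrow> (\<And>j. j \<in> {1..k::nat} \<Longrightarrow> x j \<in> M) \<Longrightarrow> 0 < \<epsilon> \<Longrightarrow>
        \<exists>N'\<in>H. \<forall>j\<in>{1..k}. norm2 \<phi> (E N' (x j) - E N (x j)) < \<epsilon>"
  shows "relative_haagerup \<phi> \<pi> \<Omega> N P"
  unfolding relative_haagerup_def
proof (intro allI impI)
  fix \<epsilon> :: real and k :: nat and x :: "nat \<Rightarrow> 'h op"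
  assume \<epsilon>: "0 < \<epsilon>" and k: "1 \<le> k" and x: "\<forall>j\<in>{1..k}. x j \<in> N \<and> norm (x j) \<le> 1"
  have xM: "x j \<in> M" if "j \<in> {1..k}" for j
    using x that expected_in[OF N] by blast
  obtain N' where "N' \<in> H" and close: "\<forall>j\<in>{1..k}. norm2 \<phi> (E N' (x j) - E N (x j)) < \<epsilon>/2"
    using lim[of k x, OF k xM half_gt_zero[OF \<epsilon>]] by blast
  then have N': "N' \<in> expected" and PN': "P \<subseteq> N'" and haagerup: "relative_haagerup \<phi> \<pi> \<Omega> N' P"
    using H by auto
  have "\<forall>j\<in>{1..k}. E N' (x j) \<in> N' \<and> norm (E N' (x j)) \<le> 1"
    using x xM E_in[OF N'] ucp.\<Phi>_norm_le[OF E_ucp[OF N']] order_trans by blast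
  then have "\<exists>\<Phi>. ucp_map N' N' \<Phi> \<and> normal_map N' N' \<Phi> \<and> bimodular P N' \<Phi> \<and>
      (\<forall>y\<in>N'. op_pos y \<longrightarrow> Re (\<phi> (\<Phi> y)) \<le> Re (\<phi> y)) \<and>
      hat_op \<pi> \<Omega> N' \<Phi> \<in> relative_compacts \<pi> \<Omega> N' P \<and>
      (\<forall>j\<in>{1..k}. norm2 \<phi> (\<Phi> (E N' (x j)) - E N' (x j)) < \<epsilon>/2)"
    using haagerup half_gt_zero[OF \<epsilon>] k unfolding relative_haagerup_def
    by (elim allE[of _ "\<epsilon>/2"] allE[of _ k] allE[of _ "\<lambda>j. E N' (x j)"] impE) simp_all
  then obtain \<Phi> where \<Phi>: "ucp_map N' N' \<Phi>" "normal_map N' N' \<Phi>" "bimodular P N' \<Phi>"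
      "\<And>y. y \<in> N' \<Longrightarrow> op_pos y \<Longrightarrow> Re (\<phi> (\<Phi> y)) \<le> Re (\<phi> y)"
      "hat_op \<pi> \<Omega> N' \<Phi> \<in> relative_compacts \<pi> \<Omega> N' P"
      "\<forall>j\<in>{1..k}. norm2 \<phi> (\<Phi> (E N' (x j)) - E N' (x j)) < \<epsilon>/2"
    by blast
  note maps = P N N' PN PN' \<Phi>(1)
  have "norm2 \<phi> (E N (\<Phi> (E N' (x j))) - x j) < \<epsilon>" if "j \<in> {1..k}" for j
    using compress_close[OF maps \<Phi>(4), of "x j" "\<epsilon>/2" "\<epsilon>/2"] x close \<Phi>(6) that by simp
  then show "\<exists>\<Phi>. ucp_map N N \<Phi> \<and> normal_map N N \<Phi> \<and> bimodular P N \<Phi> \<and>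
      (\<forall>y\<in>N. op_pos y \<longrightarrow> Re (\<phi> (\<Phi> y)) \<le> Re (\<phi> y)) \<and>
      hat_op \<pi> \<Omega> N \<Phi> \<in> relative_compacts \<pi> \<Omega> N P \<and>
      (\<forall>j\<in>{1..k}. norm2 \<phi> (\<Phi> (x j) - x j) < \<epsilon>)"
    using compress_ucp[OF maps] compress_normal[OF maps \<Phi>(2)] compress_bimodular[OF maps \<Phi>(3)]
      compress_\<phi>_le[OF maps \<Phi>(4)] compress_hat[OF maps \<Phi>(4,5)]
    by (intro exI[of _ "\<lambda>x. E N (\<Phi> (E N' x))"]) blast
qed

end

theorem theorem5p7:
  fixes M P :: "'h::complex_hilbert op set"
    and \<phi> :: "'h op \<Rightarrow> complex"
    and \<pi> :: "'h op \<Rightarrow> 'k::complex_hilbert op"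
    and \<Omega> :: 'k
  assumes "von_neumann_algebra M"
    and "separable_predual M"
    and "faithful_normal_state M \<phi>"
    and "gns_representation M \<phi> \<pi> \<Omega>"
    and "P \<in> expected_subalgebras M \<phi>"
  shows "closedin (expected_topology M \<phi>)
           {N \<in> expected_subalgebras M \<phi>. P \<subseteq> N \<and> relative_haagerup \<phi> \<pi> \<Omega> N P}"
proof -
  interpret gns M \<phi> \<pi> \<Omega>
    using assms by unfold_locales
  let ?H = "{N \<in> expected_subalgebras M \<phi>. P \<subseteq> N \<and> relative_haagerup \<phi> \<pi> \<Omega> N P}"
  show ?thesis
  proof (rule closedin_expectedI)
    fix N assume N: "N \<in> expected"
      and lim: "\<And>k x \<epsilon>. 1 \<le> k \<Longrightarrow> (\<And>j. j \<in> {1..k::nat} \<Longrightarrow> x j \<in> M) \<Longrightarrow> 0 < \<epsilon> \<Longrightarrow>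
        \<exists>N'\<in>?H. \<forall>j\<in>{1..k}. norm2 \<phi> (E N' (x j) - E N (x j)) < \<epsilon>"
    have "\<exists>N'\<in>?H. norm2 \<phi> (E N' x - E N x) < \<epsilon>" if "x \<in> M" "0 < \<epsilon>" for x \<epsilon>
      using lim[of 1 "\<lambda>_. x" \<epsilon>] that by simp
    then have PN: "P \<subseteq> N"
      using limit_contains[OF expected_subset[OF assms(5)] N, of ?H] by blast
    moreover have "relative_haagerup \<phi> \<pi> \<Omega> N P"
      using limit_haagerup[OF assms(5) N PN, of ?H] lim by blast
    ultimately show "N \<in> ?H"
      using N by blast
  qed blast
qed

end
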